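(* Suppose $\eta_t$ is a noisy exclusion process on $\{0,1\}^{\mathbb{Z}^d}$ with transition rates $q_e(x,y)$ (not necessarily symmetric) that are irreducible with respect to $\mathbb{Z}^d$ and have finite range $N$, i.e. $q_e(x,y)=0$ when $|x-y|>N$. Let $\{b_l\}$ be a nonnegative sequence satisfying (a) $\sum_l b_l=\infty$ if $d=1$, and (b) $\lim_{l\to\infty}l\,b_l=\infty$ if $d\ge 2$. If $p(l)$ is a nonnegative function on $\mathbb{N}$ that satisfies $p(l+1)\ge p(l)+N$ for all $l$ and is bounded by $kl^k$ for some $k>0$, and if $\beta,\delta$ satisfy $\beta(x)+\delta(x)\ge b_l$ for all $x\in T_{p(l)}^N$ (for every $l$) and $\beta(x)=\delta(x)=0$ for all $x$ lying in none of the sets $T_{p(l)}^N$, then $\eta_t$ is ergodic.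
   Context: For $n\ge0$, $T_n=\{x\in\mathbb{Z}^d:|x_i|\le n\text{ for all }i\}$ and $T_n^N=T_{n+N}\setminus T_n$. The noisy exclusion process with exclusion rates $q_e(x,y)\ge0$, birth rates $\beta(x)\ge0$ and death rates $\delta(x)\ge 0$ is the Feller process on $\{0,1\}^{\mathbb{Z}^d}$ whose generator is the closure of the operator, defined on functions $f$ depending on finitely many coordinates, $$\Omega f(\eta)=\sum_{\eta(x)=1,\eta(y)=0}q_e(x,y)[f(\eta_{xy})-f(\eta)]+\sum_x c(x,\eta)[f(\eta_x)-f(\eta)],$$ where $c(x,\eta)=\beta(x)$ if $\eta(x)=0$, $c(x,\eta)=\delta(x)$ if $\eta(x)=1$, $\eta_x$ is $\eta$ with the value at $x$ replaced by $1-\eta(x)$, and $\eta_{xy}$ is $\eta$ with the values at $x$ and $y$ interchanged. Standing assumptions: $\sup_x\sum_y q_e(x,y)<\infty$, $\inf_x\sum_y q_e(x,y)>0$, and $\sup_x(\beta(x)+\delta(x))<\infty$. The process is ergodic if there is a unique invariant probability measure $\nu$ and, for every initial law $\mu$ on $\{0,1\}^{\mathbb{Z}^d}$, the law at time $t$ converges weakly to $\nu$ as $t\to\infty$. *)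

theory Defs
  imports "HOL-Probability.Probability"
begin

text \<open>
  Sites are points of \<open>\<int>\<^sup>d\<close>, rendered as \<^typ>\<open>int ^ 'd\<close> with \<open>d = CARD('d)\<close>. A configuration
  \<open>\<eta>\<close> has \<open>\<eta> x = True\<close> iff the site \<open>x\<close> is occupied (value 1). The function space carries the
  product topology of the library, so it is compact, and \<^term>\<open>borel\<close> on it is the Borel
  sigma-algebra of \<open>{0,1}\<close> to the power \<open>\<int>\<^sup>d\<close>.
\<close>

type_synonym 'd config = "int ^ 'd \<Rightarrow> bool"


subsection \<open>Geometry of the lattice\<close>

text \<open>The norm is the maximum norm, the one whose balls are the boxes \<open>T\<^sub>n\<close>. Radii are real.\<close>

definition lattice_norm :: "int ^ 'd \<Rightarrow> int" where
  "lattice_norm x = Max (range (\<lambda>i. \<bar>x $ i\<bar>))"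

definition T_box :: "real \<Rightarrow> (int ^ 'd) set" where
  "T_box r = {x. \<forall>i. real_of_int \<bar>x $ i\<bar> \<le> r}"

definition T_shell :: "nat \<Rightarrow> real \<Rightarrow> (int ^ 'd) set" where
  "T_shell N r = T_box (r + real N) - T_box r"

definition finite_range :: "nat \<Rightarrow> (int ^ 'd \<Rightarrow> int ^ 'd \<Rightarrow> real) \<Rightarrow> bool" where
  "finite_range N q \<longleftrightarrow> (\<forall>x y. lattice_norm (x - y) > int N \<longrightarrow> q x y = 0)"

definition irreducible_rates :: "(int ^ 'd \<Rightarrow> int ^ 'd \<Rightarrow> real) \<Rightarrow> bool" where
  "irreducible_rates q \<longleftrightarrow> (\<forall>x y. (\<lambda>u v. q u v > 0)\<^sup>*\<^sup>* x y)"


subsection \<open>The pregenerator\<close>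

text \<open>The standing assumptions on the rates. Summability is stated separately because
  \<^const>\<open>infsum\<close> is 0 on families that are not summable.\<close>

definition noisy_exclusion_rates ::
    "(int ^ 'd \<Rightarrow> int ^ 'd \<Rightarrow> real) \<Rightarrow> (int ^ 'd \<Rightarrow> real) \<Rightarrow> (int ^ 'd \<Rightarrow> real) \<Rightarrow> bool" where
  "noisy_exclusion_rates q \<beta> \<delta> \<longleftrightarrow>
     (\<forall>x y. 0 \<le> q x y) \<and> (\<forall>x. 0 \<le> \<beta> x) \<and> (\<forall>x. 0 \<le> \<delta> x) \<and>
     (\<forall>x. (\<lambda>y. q x y) summable_on UNIV) \<and>
     bdd_above (range (\<lambda>x. \<Sum>\<^sub>\<infinity>y. q x y)) \<and>
     0 < (INF x. \<Sum>\<^sub>\<infinity>y. q x y) \<and>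
     bdd_above (range (\<lambda>x. \<beta> x + \<delta> x))"

definition flip :: "'d config \<Rightarrow> int ^ 'd \<Rightarrow> 'd config" where
  "flip \<eta> x = \<eta>(x := \<not> \<eta> x)"

definition exchange :: "'d config \<Rightarrow> int ^ 'd \<Rightarrow> int ^ 'd \<Rightarrow> 'd config" where
  "exchange \<eta> x y = \<eta>(x := \<eta> y, y := \<eta> x)"

definition flip_rate :: "(int ^ 'd \<Rightarrow> real) \<Rightarrow> (int ^ 'd \<Rightarrow> real) \<Rightarrow> int ^ 'd \<Rightarrow> 'd config \<Rightarrow> real" where
  "flip_rate \<beta> \<delta> x \<eta> = (if \<eta> x then \<delta> x else \<beta> x)"

definition \<Omega> ::
    "(int ^ 'd \<Rightarrow> int ^ 'd \<Rightarrow> real) \<Rightarrow> (int ^ 'd \<Rightarrow> real) \<Rightarrow> (int ^ 'd \<Rightarrow> real)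
      \<Rightarrow> ('d config \<Rightarrow> real) \<Rightarrow> 'd config \<Rightarrow> real" where
  "\<Omega> q \<beta> \<delta> f \<eta> =
     (\<Sum>\<^sub>\<infinity>(x, y)\<in>{(x, y). \<eta> x \<and> \<not> \<eta> y}. q x y * (f (exchange \<eta> x y) - f \<eta>)) +
     (\<Sum>\<^sub>\<infinity>x. flip_rate \<beta> \<delta> x \<eta> * (f (flip \<eta> x) - f \<eta>))"

definition cylinder_function :: "('d config \<Rightarrow> real) \<Rightarrow> bool" where
  "cylinder_function f \<longleftrightarrow>
     (\<exists>A. finite A \<and> (\<forall>\<eta> \<zeta>. (\<forall>x\<in>A. \<eta> x = \<zeta> x) \<longrightarrow> f \<eta> = f \<zeta>))"

text \<open>Operators on \<open>C(X)\<close> are identified with their graphs. As the configuration space is compact,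
  \<open>C(X)\<close> with the supremum norm is the type of bounded continuous functions.\<close>

definition pregenerator_graph ::
    "(int ^ 'd \<Rightarrow> int ^ 'd \<Rightarrow> real) \<Rightarrow> (int ^ 'd \<Rightarrow> real) \<Rightarrow> (int ^ 'd \<Rightarrow> real)
      \<Rightarrow> (('d config \<Rightarrow>\<^sub>C real) \<times> ('d config \<Rightarrow>\<^sub>C real)) set" where
  "pregenerator_graph q \<beta> \<delta> =
     {(f, g). cylinder_function (apply_bcontfun f) \<and>
              apply_bcontfun g = \<Omega> q \<beta> \<delta> (apply_bcontfun f)}"


subsection \<open>Feller processes and their generators\<close>

text \<open>A Feller process is given by its transition function: \<open>P t \<eta>\<close> is the law at time \<open>t\<close> of the
  process started from \<open>\<eta>\<close>. Its semigroup is \<open>S(t) f(\<eta>) = E\<^sup>\<eta> f(\<eta>\<^sub>t)\<close>. Only times \<open>t \<ge> 0\<close> matter.\<close>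

definition semigroup_of :: "(real \<Rightarrow> 'd config \<Rightarrow> 'd config measure) \<Rightarrow> real
      \<Rightarrow> ('d config \<Rightarrow> real) \<Rightarrow> 'd config \<Rightarrow> real" where
  "semigroup_of P t f \<eta> = (\<integral>\<zeta>. f \<zeta> \<partial>P t \<eta>)"

definition feller_process :: "(real \<Rightarrow> 'd config \<Rightarrow> 'd config measure) \<Rightarrow> bool" where
  "feller_process P \<longleftrightarrow>
     (\<forall>t\<ge>0. P t \<in> borel \<rightarrow>\<^sub>M prob_algebra borel) \<and>
     (\<forall>\<eta>. P 0 \<eta> = return borel \<eta>) \<and>
     (\<forall>s\<ge>0. \<forall>t\<ge>0. \<forall>\<eta>. P (s + t) \<eta> = P s \<eta> \<bind> P t) \<and>
     (\<forall>t\<ge>0. \<forall>f. continuous_on UNIV f \<longrightarrow> continuous_on UNIV (semigroup_of P t f)) \<and>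
     (\<forall>f. continuous_on UNIV f \<longrightarrow>
        uniform_limit UNIV (\<lambda>t. semigroup_of P t f) f (at_right 0))"

definition generator_graph :: "(real \<Rightarrow> 'd config \<Rightarrow> 'd config measure)
      \<Rightarrow> (('d config \<Rightarrow>\<^sub>C real) \<times> ('d config \<Rightarrow>\<^sub>C real)) set" where
  "generator_graph P =
     {(f, g). uniform_limit UNIV
        (\<lambda>t \<eta>. (semigroup_of P t (apply_bcontfun f) \<eta> - apply_bcontfun f \<eta>) / t)
        (apply_bcontfun g) (at_right 0)}"

definition noisy_exclusion_process ::
    "(int ^ 'd \<Rightarrow> int ^ 'd \<Rightarrow> real) \<Rightarrow> (int ^ 'd \<Rightarrow> real) \<Rightarrow> (int ^ 'd \<Rightarrow> real)
      \<Rightarrow> (real \<Rightarrow> 'd config \<Rightarrow> 'd config measure) \<Rightarrow> bool" where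
  "noisy_exclusion_process q \<beta> \<delta> P \<longleftrightarrow>
     noisy_exclusion_rates q \<beta> \<delta> \<and> feller_process P \<and>
     generator_graph P = closure (pregenerator_graph q \<beta> \<delta>)"


subsection \<open>Ergodicity\<close>

definition law_at :: "(real \<Rightarrow> 'd config \<Rightarrow> 'd config measure) \<Rightarrow> 'd config measure \<Rightarrow> real
      \<Rightarrow> 'd config measure" where
  "law_at P \<mu> t = \<mu> \<bind> P t"

definition invariant_law :: "(real \<Rightarrow> 'd config \<Rightarrow> 'd config measure) \<Rightarrow> 'd config measure \<Rightarrow> bool" where
  "invariant_law P \<nu> \<longleftrightarrow> \<nu> \<in> space (prob_algebra borel) \<and> (\<forall>t\<ge>0. law_at P \<nu> t = \<nu>)"

definition converges_weakly :: "(real \<Rightarrow> 'd config measure) \<Rightarrow> 'd config measure \<Rightarrow> bool" where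
  "converges_weakly m \<nu> \<longleftrightarrow>
     (\<forall>f :: 'd config \<Rightarrow> real. continuous_on UNIV f \<and> bounded (range f) \<longrightarrow>
        ((\<lambda>t. \<integral>\<eta>. f \<eta> \<partial>m t) \<longlongrightarrow> (\<integral>\<eta>. f \<eta> \<partial>\<nu>)) at_top)"

definition ergodic :: "(real \<Rightarrow> 'd config \<Rightarrow> 'd config measure) \<Rightarrow> bool" where
  "ergodic P \<longleftrightarrow>
     (\<exists>\<nu>. invariant_law P \<nu> \<and> (\<forall>\<nu>'. invariant_law P \<nu>' \<longrightarrow> \<nu>' = \<nu>) \<and>
          (\<forall>\<mu>\<in>space (prob_algebra borel). converges_weakly (law_at P \<mu>) \<nu>))"

end

theory Submission
  imports Defs
begin

text \<open>
  Every elementary transition acts on all configurations by a monotone map, so the process is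
  attractive: its semigroup preserves monotone functions. Started from the empty configuration its
  law therefore increases in time, started from the full configuration it decreases, and every
  other initial law is squeezed between these two. Ergodicity means that the two limits agree, and
  for this it suffices that \<open>disc x\<close>, the difference of the two limiting occupation probabilities,
  vanishes at every site. In the basic coupling of the two processes, \<open>disc x\<close> is the limiting
  probability of a discrepancy at \<open>x\<close>.

  The coupled process is never constructed. Only two properties of a coupling matter, and both can
  be read off from the linear functional \<open>gap\<close>, the difference of the two limits on cylinder
  functions: it is nonnegative on monotone functions, and it annihilates \<open>\<Omega> f\<close> for every cylinder
  function \<open>f\<close>. The first is attractiveness (\<open>S_attractive\<close>). It comes from a minimum principle for
  the increments \<open>f \<zeta> - f \<eta>\<close> over ordered pairs \<open>\<eta> \<le> \<zeta>\<close>, which holds for cylinder functions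
  (\<open>\<Omega>_minimum_principle\<close>) and passes to the whole domain of the generator because the cylinder
  functions form a core. The second is \<open>gap_\<Omega>\<close>.

  Applying the second property to the number of particles in a box gives \<open>flux_inequality\<close>: the rate
  at which the noise in the box removes discrepancies is at most a constant \<open>K\<close> times the number of
  discrepancies in the shell of width \<open>N\<close> around the box. Write \<open>A l\<close> for the total of \<open>disc\<close> over
  the \<open>l\<close>-th noisy shell. The noisy shells are disjoint, so
  \<open>b 1 * A 1 + \<dots> + b (l - 1) * A (l - 1) \<le> K * A l\<close>. If no \<open>A l\<close> vanished, the left side would be
  multiplied by at least \<open>1 + b l / K\<close> with each shell. In dimension one the product of these factors
  diverges, whereas \<open>A l\<close> is bounded. In higher dimensions the product outgrows every power of \<open>l\<close>,
  whereas \<open>A l\<close> is at most the number of sites of a box of polynomially growing size. So some shell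
  carries no discrepancies at all, and by irreducibility no other site does either
  (\<open>disc_zero_everywhere\<close>): from any pair of ordered configurations with a discrepancy somewhere,
  finitely many possible transitions lead to a pair with a discrepancy at the given site.
\<close>

section \<open>Cylinder functions and measures on the configuration space\<close>

lemma cylinder_functionI:
  assumes "finite A" and "\<And>\<eta> \<zeta>. (\<And>x. x \<in> A \<Longrightarrow> \<eta> x = \<zeta> x) \<Longrightarrow> f \<eta> = f (\<zeta> :: 'd config)"
  shows "cylinder_function f"
  using assms unfolding cylinder_function_def by blast

lemma cylinder_const [simp]: "cylinder_function (\<lambda>_. c)"
  by (rule cylinder_functionI[of "{}"]) auto

lemma cylinder_comp2:
  assumes "cylinder_function f" "cylinder_function g"
  shows "cylinder_function (\<lambda>\<eta>. h (f \<eta>) (g \<eta>))"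
proof -
  obtain A where A: "finite A" "\<forall>\<eta> \<zeta>. (\<forall>x\<in>A. \<eta> x = \<zeta> x) \<longrightarrow> f \<eta> = f \<zeta>"
    using assms(1) by (auto simp: cylinder_function_def)
  obtain B where B: "finite B" "\<forall>\<eta> \<zeta>. (\<forall>x\<in>B. \<eta> x = \<zeta> x) \<longrightarrow> g \<eta> = g \<zeta>"
    using assms(2) by (auto simp: cylinder_function_def)
  show ?thesis
  proof (rule cylinder_functionI[of "A \<union> B"])
    show "finite (A \<union> B)" using A B by simp
  next
    fix \<eta> \<zeta> :: "'a config" assume *: "\<And>x. x \<in> A \<union> B \<Longrightarrow> \<eta> x = \<zeta> x"
    have "f \<eta> = f \<zeta>" by (rule A(2)[rule_format]) (use * in auto)
    moreover have "g \<eta> = g \<zeta>" by (rule B(2)[rule_format]) (use * in auto)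
    ultimately show "h (f \<eta>) (g \<eta>) = h (f \<zeta>) (g \<zeta>)" by simp
  qed
qed

lemma cylinder_comp:
  assumes "cylinder_function f"
  shows "cylinder_function (\<lambda>\<eta>. h (f \<eta>))"
  using cylinder_comp2[OF assms assms, of "\<lambda>a _. h a"] .

lemma cylinder_sum:
  assumes "\<And>i. i \<in> I \<Longrightarrow> cylinder_function (f i)"
  shows "cylinder_function (\<lambda>\<eta>. \<Sum>i\<in>I. f i \<eta>)"
  using assms
proof (induction I rule: infinite_finite_induct)
  case (insert i I)
  then show ?case
    using cylinder_comp2[of "f i" "\<lambda>\<eta>. \<Sum>i\<in>I. f i \<eta>" "(+)"] by simp
qed auto

lemma cylinder_of_bool_site [simp]: "cylinder_function (\<lambda>\<eta>. of_bool (\<eta> x) :: real)"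
  by (rule cylinder_functionI[of "{x}"]) auto

lemma open_agree:
  fixes \<eta> :: "'d::finite config"
  assumes "finite A"
  shows "open {\<zeta>. \<forall>x\<in>A. \<zeta> x = \<eta> x}"
proof -
  have "open {\<zeta> :: 'd config. \<zeta> x = \<eta> x}" for x
  proof -
    have "open ((\<lambda>\<zeta> :: 'd config. \<zeta> x) -` {\<eta> x} \<inter> UNIV)"
      using Topological_Spaces.open_discrete[of "{\<eta> x}"]
      by (intro continuous_on_open_vimage[THEN iffD1, rule_format]) auto
    then show ?thesis by (simp add: vimage_def)
  qed
  moreover have "{\<zeta>. \<forall>x\<in>A. \<zeta> x = \<eta> x} = (\<Inter>x\<in>A. {\<zeta>. \<zeta> x = \<eta> x})" by auto
  ultimately show ?thesis using assms by (auto intro: open_INT)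
qed

lemma open_contains_agree:
  fixes \<eta> :: "'d::finite config"
  assumes "open U" "\<eta> \<in> U"
  obtains A where "finite A" "{\<zeta>. \<forall>x\<in>A. \<zeta> x = \<eta> x} \<subseteq> U"
proof -
  have "openin (product_topology (\<lambda>_. euclidean) UNIV) U"
    using assms(1) by (simp add: open_fun_def)
  from product_topology_open_contains_basis[OF this assms(2)]
  obtain X where X: "\<eta> \<in> (\<Pi>\<^sub>E i\<in>UNIV. X i)" "finite {i. X i \<noteq> (UNIV :: bool set)}"
    "(\<Pi>\<^sub>E i\<in>UNIV. X i) \<subseteq> U" by auto
  have "{\<zeta>. \<forall>x\<in>{i. X i \<noteq> UNIV}. \<zeta> x = \<eta> x} \<subseteq> U"
  proof
    fix \<zeta> assume *: "\<zeta> \<in> {\<zeta>. \<forall>x\<in>{i. X i \<noteq> UNIV}. \<zeta> x = \<eta> x}"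
    have "\<zeta> x \<in> X x" for x using X(1) * by (cases "X x = UNIV") (auto simp: PiE_iff)
    then show "\<zeta> \<in> U" using X(3) by (auto simp: PiE_iff)
  qed
  with X(2) show ?thesis by (rule that)
qed

lemma cylinder_continuous:
  fixes f :: "'d::finite config \<Rightarrow> real"
  assumes "cylinder_function f"
  shows "continuous_on S f"
proof -
  obtain A where A: "finite A" "\<forall>\<eta> \<zeta>. (\<forall>x\<in>A. \<eta> x = \<zeta> x) \<longrightarrow> f \<eta> = f \<zeta>"
    using assms by (auto simp: cylinder_function_def)
  have "open (f -` V)" for V
  proof -
    have "f -` V = (\<Union>\<eta>\<in>f -` V. {\<zeta>. \<forall>x\<in>A. \<zeta> x = \<eta> x})"
    proof (intro equalityI subsetI)
      fix \<zeta> assume "\<zeta> \<in> (\<Union>\<eta>\<in>f -` V. {\<zeta>. \<forall>x\<in>A. \<zeta> x = \<eta> x})"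
      then obtain \<eta> where "\<eta> \<in> f -` V" "\<forall>x\<in>A. \<zeta> x = \<eta> x" by auto
      moreover then have "f \<zeta> = f \<eta>" by (intro A(2)[rule_format]) auto
      ultimately show "\<zeta> \<in> f -` V" by simp
    qed auto
    moreover have "open (\<Union>\<eta>\<in>f -` V. {\<zeta>. \<forall>x\<in>A. \<zeta> x = \<eta> x})"
      by (intro open_UN ballI open_agree A(1))
    ultimately show ?thesis by simp
  qed
  then have "continuous_on UNIV f" by (simp add: continuous_on_open_vimage)
  then show ?thesis by (rule continuous_on_subset) simp
qed

lemma compact_configs: "compact (UNIV :: 'd::finite config set)"
proof -
  have "compact_space (product_topology (\<lambda>_ :: int ^ 'd. euclidean :: bool topology) UNIV)"
    by (subst compact_space_product_topology) (auto simp: compact_space_def intro: finite_imp_compact)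
  then show ?thesis
    by (simp add: euclidean_product_topology compact_space_def)
qed

lemma continuous_config_bounded:
  fixes f :: "'d::finite config \<Rightarrow> real"
  assumes "continuous_on UNIV f"
  obtains B where "\<And>\<eta>. \<bar>f \<eta>\<bar> \<le> B" "B > 0"
proof -
  have "bounded (f ` UNIV)"
    using compact_continuous_image[OF assms compact_configs] by (rule compact_imp_bounded)
  then obtain B where "B > 0" "\<forall>y\<in>range f. norm y \<le> B" unfolding bounded_pos by blast
  then show ?thesis by (intro that[of B]) auto
qed

text \<open>By compactness a continuous function is, up to a small error, insensitive to all but finitely
  many sites; emptying the other sites gives the approximating cylinder function.\<close>

lemma cylinder_functions_dense:
  fixes f :: "'d::finite config \<Rightarrow> real"
  assumes "continuous_on UNIV f" "e > 0"
  obtains g where "cylinder_function g" "\<And>\<eta>. \<bar>f \<eta> - g \<eta>\<bar> < e"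
proof -
  have "\<exists>A. finite A \<and> (\<forall>\<zeta>. (\<forall>x\<in>A. \<zeta> x = \<eta> x) \<longrightarrow> \<bar>f \<zeta> - f \<eta>\<bar> < e / 2)" for \<eta>
  proof -
    have "open (f -` {f \<eta> - e / 2 <..< f \<eta> + e / 2})"
      using assms(1) by (simp add: continuous_on_open_vimage)
    moreover have "\<eta> \<in> f -` {f \<eta> - e / 2 <..< f \<eta> + e / 2}" using assms(2) by simp
    ultimately obtain A where "finite A"
      "{\<zeta>. \<forall>x\<in>A. \<zeta> x = \<eta> x} \<subseteq> f -` {f \<eta> - e / 2 <..< f \<eta> + e / 2}"
      by (rule open_contains_agree)
    moreover have "\<bar>f \<zeta> - f \<eta>\<bar> < e / 2" if "\<zeta> \<in> f -` {f \<eta> - e / 2 <..< f \<eta> + e / 2}" for \<zeta>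
    proof -
      have "f \<eta> - e / 2 < f \<zeta>" "f \<zeta> < f \<eta> + e / 2" using that by simp_all
      then show ?thesis by linarith
    qed
    ultimately show ?thesis by (intro exI[of _ A] conjI allI impI) (simp_all add: subset_iff)
  qed
  then have "\<exists>A. \<forall>\<eta>. finite (A \<eta>) \<and> (\<forall>\<zeta>. (\<forall>x\<in>A \<eta>. \<zeta> x = \<eta> x) \<longrightarrow> \<bar>f \<zeta> - f \<eta>\<bar> < e / 2)"
    by (intro choice allI)
  then obtain A where A0: "\<forall>\<eta>. finite (A \<eta>) \<and> (\<forall>\<zeta>. (\<forall>x\<in>A \<eta>. \<zeta> x = \<eta> x) \<longrightarrow> \<bar>f \<zeta> - f \<eta>\<bar> < e / 2)"
    by (elim exE)
  have A: "finite (A \<eta>)" "(\<forall>x\<in>A \<eta>. \<zeta> x = \<eta> x) \<Longrightarrow> \<bar>f \<zeta> - f \<eta>\<bar> < e / 2" for \<eta> \<zeta>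
    using A0 by simp_all
  have "UNIV \<subseteq> (\<Union>\<eta>\<in>UNIV. {\<zeta>. \<forall>x\<in>A \<eta>. \<zeta> x = \<eta> x})" by auto
  with compact_configs open_agree[OF A(1)]
  obtain C where C: "finite C" "UNIV \<subseteq> (\<Union>\<eta>\<in>C. {\<zeta>. \<forall>x\<in>A \<eta>. \<zeta> x = \<eta> x})"
    by (rule compactE_image)
  define B where "B = (\<Union>\<eta>\<in>C. A \<eta>)"
  define g where "g = (\<lambda>\<zeta>. f (\<lambda>x. x \<in> B \<and> \<zeta> x))"
  show ?thesis
  proof (rule that[of g])
    show "cylinder_function g"
    proof (rule cylinder_functionI[of B])
      show "finite B" using C(1) A(1) by (auto simp: B_def)
      fix \<eta> \<zeta> :: "'d config" assume "\<And>x. x \<in> B \<Longrightarrow> \<eta> x = \<zeta> x"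
      then have "(\<lambda>x. x \<in> B \<and> \<eta> x) = (\<lambda>x. x \<in> B \<and> \<zeta> x)" by auto
      then show "g \<eta> = g \<zeta>" by (simp add: g_def)
    qed
  next
    fix \<zeta>
    obtain \<eta> where \<eta>: "\<eta> \<in> C" "\<forall>x\<in>A \<eta>. \<zeta> x = \<eta> x" using C(2) by blast
    then have "\<forall>x\<in>A \<eta>. (x \<in> B \<and> \<zeta> x) = \<eta> x" by (auto simp: B_def)
    then have "\<bar>f (\<lambda>x. x \<in> B \<and> \<zeta> x) - f \<eta>\<bar> < e / 2" by (rule A(2))
    moreover have "\<bar>f \<zeta> - f \<eta>\<bar> < e / 2" using \<eta>(2) by (rule A(2))
    ultimately show "\<bar>f \<zeta> - g \<zeta>\<bar> < e" unfolding g_def by linarith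
  qed
qed

lemma cylinder_finite_range:
  fixes f :: "'d::finite config \<Rightarrow> real"
  assumes "cylinder_function f"
  shows "finite (range f)"
proof -
  obtain A where A: "finite A" "\<forall>\<eta> \<zeta>. (\<forall>x\<in>A. \<eta> x = \<zeta> x) \<longrightarrow> f \<eta> = f \<zeta>"
    using assms by (auto simp: cylinder_function_def)
  have "range f \<subseteq> (\<lambda>S. f (\<lambda>x. x \<in> S)) ` Pow A"
  proof
    fix v assume "v \<in> range f"
    then obtain \<eta> where "v = f \<eta>" by auto
    also have "f \<eta> = f (\<lambda>x. x \<in> {x\<in>A. \<eta> x})" by (rule A(2)[rule_format]) auto
    finally show "v \<in> (\<lambda>S. f (\<lambda>x. x \<in> S)) ` Pow A" by blast
  qed
  then show ?thesis using A(1) by (meson finite_Pow_iff finite_imageI finite_subset)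
qed

abbreviation cylinder_events :: "'d::finite config set set" where
  "cylinder_events \<equiv> {E. cylinder_function (indicat_real E)}"

lemma cylinder_event_clopen:
  assumes "E \<in> cylinder_events"
  shows "open E" "closed E"
proof -
  have c: "continuous_on UNIV (indicat_real E)" using assms by (auto intro: cylinder_continuous)
  have "open (indicat_real E -` {1/2 <..})" "open (indicat_real E -` {..< 1/2})"
    using c by (simp_all add: continuous_on_open_vimage)
  moreover have "indicat_real E -` {1/2 <..} = E" "indicat_real E -` {..< 1/2} = - E"
    by (auto simp: indicator_def of_bool_def split: if_splits)
  ultimately show "open E" "closed E" by (simp_all add: closed_def)
qed

lemma cylinder_event_preimage:
  assumes "cylinder_function f"
  shows "{\<eta>. f \<eta> \<in> V} \<in> cylinder_events"
proof -
  have "indicat_real {\<eta>. f \<eta> \<in> V} = (\<lambda>\<eta>. indicator V (f \<eta>))" by (auto simp: indicator_def)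
  then show ?thesis using cylinder_comp[OF assms, of "indicator V"] by simp
qed

lemma algebra_cylinder_events: "algebra UNIV (cylinder_events :: 'd::finite config set set)"
proof -
  have Int: "A \<inter> B \<in> cylinder_events" if "A \<in> cylinder_events" "B \<in> cylinder_events"
    for A B :: "'d config set"
  proof -
    have "indicat_real (A \<inter> B) = (\<lambda>\<eta>. indicat_real A \<eta> * indicat_real B \<eta>)"
      by (rule ext) (rule indicator_inter_arith)
    then show ?thesis using that cylinder_comp2[of "indicat_real A" "indicat_real B" "(*)"] by simp
  qed
  have Diff: "UNIV - A \<in> cylinder_events" if "A \<in> cylinder_events" for A :: "'d config set"
  proof -
    have "indicat_real (UNIV - A) = (\<lambda>\<eta>. 1 - indicat_real A \<eta>)"
      by (auto simp: indicator_def)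
    then show ?thesis using that cylinder_comp[of "indicat_real A" "\<lambda>a. 1 - a"] by simp
  qed
  have empty: "({} :: 'd config set) \<in> cylinder_events"
  proof -
    have "indicat_real ({} :: 'd config set) = (\<lambda>_. 0)" by (rule ext) simp
    then show ?thesis by simp
  qed
  show ?thesis
    unfolding algebra_iff_Int by (intro conjI ballI empty Diff Int) simp_all
qed

lemma sets_borel_cylinders:
  "sets (borel :: 'd::finite config measure) = sigma_sets UNIV cylinder_events"
proof
  have "U \<in> sigma_sets UNIV cylinder_events" if U: "open U" for U :: "'d config set"
  proof -
    let ?C = "\<lambda>(A, S). {\<zeta> :: 'd config. \<forall>x\<in>A. \<zeta> x = (x \<in> S)}"
    define I where "I = {(A, S). finite A \<and> finite S \<and> ?C (A, S) \<subseteq> U}"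
    have "countable ({A :: (int ^ 'd) set. finite A} \<times> {S :: (int ^ 'd) set. finite S})"
      by (intro countable_SIGMA) (simp_all add: countable_Collect_finite)
    then have "countable I" by (rule countable_subset[rotated]) (auto simp: I_def)
    have "U = (\<Union>i\<in>I. ?C i)"
    proof (intro equalityI subsetI)
      fix \<eta> assume "\<eta> \<in> U"
      with U obtain A where A: "finite A" "{\<zeta>. \<forall>x\<in>A. \<zeta> x = \<eta> x} \<subseteq> U"
        by (rule open_contains_agree)
      have "?C (A, {x\<in>A. \<eta> x}) = {\<zeta>. \<forall>x\<in>A. \<zeta> x = \<eta> x}" by auto
      then have "(A, {x\<in>A. \<eta> x}) \<in> I" using A by (simp add: I_def)
      then show "\<eta> \<in> (\<Union>i\<in>I. ?C i)" by (rule UN_I) simp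
    next
      fix \<eta> assume "\<eta> \<in> (\<Union>i\<in>I. ?C i)"
      then obtain i where "i \<in> I" "\<eta> \<in> ?C i" by (rule UN_E)
      then show "\<eta> \<in> U" unfolding I_def by (cases i) (simp, fast)
    qed
    also have "\<dots> \<in> sigma_sets UNIV cylinder_events"
    proof (rule sigma_sets_UNION)
      show "countable (?C ` I)" using \<open>countable I\<close> by simp
      fix E assume "E \<in> ?C ` I"
      then obtain A S where AS: "finite A" "E = {\<zeta>. \<forall>x\<in>A. \<zeta> x = (x \<in> S)}" by (auto simp: I_def)
      have "cylinder_function (indicat_real E)"
        by (rule cylinder_functionI[OF AS(1)]) (auto simp: AS(2) indicator_def)
      then show "E \<in> sigma_sets UNIV cylinder_events" by (intro sigma_sets.Basic) simp
    qed
    finally show ?thesis .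
  qed
  then have "sigma_sets UNIV {U. open U} \<subseteq> sigma_sets UNIV (cylinder_events :: 'd config set set)"
    by (intro sigma_sets_mono) auto
  then show "sets (borel :: 'd config measure) \<subseteq> sigma_sets UNIV cylinder_events"
    by (simp add: borel_def)
next
  have "sigma_sets (space borel) cylinder_events \<subseteq> sets (borel :: 'd config measure)"
  proof (rule sets.sigma_sets_subset, rule subsetI)
    fix E :: "'d config set" assume "E \<in> cylinder_events"
    then show "E \<in> sets borel" by (intro borel_open cylinder_event_clopen(1))
  qed
  then show "sigma_sets UNIV cylinder_events \<subseteq> sets (borel :: 'd config measure)" by simp
qed

text \<open>Cylinder events are stable under intersection and generate the Borel sets.\<close>

lemma prob_eqI_cylinder:
  fixes \<mu> \<nu> :: "'d::finite config measure"
  assumes \<mu>: "\<mu> \<in> space (prob_algebra borel)" and \<nu>: "\<nu> \<in> space (prob_algebra borel)"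
    and eq: "\<And>f. cylinder_function f \<Longrightarrow> (\<integral>\<eta>. f \<eta> \<partial>\<mu>) = (\<integral>\<eta>. f \<eta> \<partial>\<nu>)"
  shows "\<mu> = \<nu>"
proof -
  interpret m: prob_space \<mu> using \<mu> by (simp add: space_prob_algebra)
  interpret n: prob_space \<nu> using \<nu> by (simp add: space_prob_algebra)
  interpret algebra UNIV "cylinder_events :: 'd config set set" by (rule algebra_cylinder_events)
  have sets [simp]: "sets \<mu> = sets borel" "sets \<nu> = sets borel"
    using \<mu> \<nu> by (auto simp: space_prob_algebra)
  have space [simp]: "space \<mu> = UNIV" "space \<nu> = UNIV"
    using sets_eq_imp_space_eq[OF sets(1)] sets_eq_imp_space_eq[OF sets(2)] by auto
  show ?thesis
  proof (rule measure_eqI_generator_eq[of "cylinder_events :: 'd config set set" UNIV \<mu> \<nu> "\<lambda>_. UNIV"])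
    show "Int_stable (cylinder_events :: 'd config set set)" by (intro Int_stableI Int)
  next
    fix E :: "'d config set" assume E: "E \<in> cylinder_events"
    then have "E \<in> sets borel" by (intro borel_open cylinder_event_clopen(1))
    then show "emeasure \<mu> E = emeasure \<nu> E"
      using eq[of "indicat_real E"] E by (simp add: m.emeasure_eq_measure n.emeasure_eq_measure)
  next
    show "range (\<lambda>_ :: nat. UNIV :: 'd config set) \<subseteq> cylinder_events" using top by auto
  qed (auto simp: sets_borel_cylinders m.emeasure_eq_measure)
qed

text \<open>Cylinder events are compact and open, so a decreasing sequence of them with empty
  intersection is eventually empty. Thus finite additivity already gives what Caratheodory's
  extension theorem needs.\<close>

lemma cylinder_functional_representation:
  fixes a :: "('d::finite config \<Rightarrow> real) \<Rightarrow> real"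
  assumes add: "\<And>f g. cylinder_function f \<Longrightarrow> cylinder_function g \<Longrightarrow>
        a (\<lambda>\<eta>. f \<eta> + g \<eta>) = a f + a g"
    and scale: "\<And>c f. cylinder_function f \<Longrightarrow> a (\<lambda>\<eta>. c * f \<eta>) = c * a f"
    and pos: "\<And>f. cylinder_function f \<Longrightarrow> (\<And>\<eta>. f \<eta> \<ge> 0) \<Longrightarrow> a f \<ge> 0"
    and one: "a (\<lambda>_. 1) = 1"
  obtains \<nu> where "\<nu> \<in> space (prob_algebra borel)"
    "\<And>f. cylinder_function f \<Longrightarrow> (\<integral>\<eta>. f \<eta> \<partial>\<nu>) = a f"
proof -
  let ?M = "cylinder_events :: 'd config set set"
  let ?m = "\<lambda>E. ennreal (a (indicat_real E))"
  interpret algebra UNIV ?M by (rule algebra_cylinder_events)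
  have a0: "a (\<lambda>_. 0) = 0" using scale[of "\<lambda>_. 0" 0] by simp
  have e0: "a (indicat_real {}) = 0"
  proof -
    have "indicat_real ({} :: 'd config set) = (\<lambda>_. 0)" by (rule ext) simp
    then show ?thesis by (simp only: a0)
  qed
  have "\<exists>\<mu> :: 'd config set \<Rightarrow> ennreal. (\<forall>s \<in> ?M. \<mu> s = ?m s) \<and> measure_space UNIV (sigma_sets UNIV ?M) \<mu>"
  proof (rule caratheodory_empty_continuous)
    show "positive ?M ?m" unfolding positive_def by (simp only: e0 ennreal_0)
  next
    show "additive ?M ?m"
      unfolding additive_def
    proof (intro ballI impI)
      fix A B assume A: "A \<in> ?M" and B: "B \<in> ?M" and d: "A \<inter> B = {}"
      have "indicat_real (A \<union> B) = (\<lambda>\<eta>. indicat_real A \<eta> + indicat_real B \<eta>)"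
        using d by (intro ext) (auto simp: indicator_def)
      then have "a (indicat_real (A \<union> B)) = a (indicat_real A) + a (indicat_real B)"
        using add[of "indicat_real A" "indicat_real B"] A B by simp
      moreover have "a (indicat_real A) \<ge> 0" "a (indicat_real B) \<ge> 0" using A B by (auto intro: pos)
      ultimately show "?m (A \<union> B) = ?m A + ?m B" by (simp add: ennreal_plus)
    qed
  next
    fix A :: "nat \<Rightarrow> 'd config set"
    assume A: "range A \<subseteq> ?M" "decseq A" "(\<Inter>i. A i) = {}"
    have "open (- A n)" for n
    proof -
      have "A n \<in> ?M" using A(1) by (rule subsetD) simp
      then have "closed (A n)" by (rule cylinder_event_clopen(2))
      then show ?thesis by (simp add: closed_def)
    qed
    moreover have "UNIV \<subseteq> (\<Union>n\<in>UNIV. - A n)" using A(3) by auto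
    ultimately obtain I where I: "finite I" "UNIV \<subseteq> (\<Union>n\<in>I. - A n)"
      by (rule compactE_image[OF compact_configs])
    have "A (Max (insert 0 I)) \<subseteq> A n" if "n \<in> I" for n
      using A(2) I(1) that by (auto simp: decseq_def)
    then have "A (Max (insert 0 I)) \<subseteq> (\<Inter>n\<in>I. A n)" by (rule INT_greatest)
    also have "\<dots> = - (\<Union>n\<in>I. - A n)" by simp
    also have "\<dots> \<subseteq> {}" using I(2) by (simp only: Compl_subset_Compl_iff flip: Compl_UNIV_eq)
    finally have "\<exists>n. A n = {}" by (intro exI[of _ "Max (insert 0 I)"]) simp
    then obtain n where n: "A n = {}" by auto
    show "(\<lambda>i. ?m (A i)) \<longlonglongrightarrow> 0"
    proof (rule tendsto_eventually)
      show "\<forall>\<^sub>F i in sequentially. ?m (A i) = 0"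
        using eventually_ge_at_top[of n]
      proof eventually_elim
        case (elim i)
        then have "A i = {}" using A(2) n by (auto simp: decseq_def)
        then show ?case by (simp only: e0 ennreal_0)
      qed
    qed
  qed simp
  then obtain \<mu> :: "'d config set \<Rightarrow> ennreal" where \<mu>: "\<And>s. s \<in> ?M \<Longrightarrow> \<mu> s = ?m s"
    "measure_space UNIV (sigma_sets UNIV ?M) \<mu>" by blast
  define \<nu> where "\<nu> = measure_of UNIV ?M \<mu>"
  have sets: "sets \<nu> = sets borel" unfolding \<nu>_def by (simp add: sets_borel_cylinders)
  have space: "space \<nu> = UNIV" unfolding \<nu>_def by simp
  have em: "emeasure \<nu> E = ?m E" if "E \<in> ?M" for E
  proof -
    have s: "sets \<nu> = sigma_sets UNIV ?M" by (simp add: \<nu>_def)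
    have "emeasure \<nu> E = \<mu> E"
    proof (rule emeasure_measure_of[OF \<nu>_def])
      show "E \<in> sets \<nu>" unfolding s using that by (rule sigma_sets.Basic)
      show "positive (sets \<nu>) \<mu>" "countably_additive (sets \<nu>) \<mu>"
        unfolding s using \<mu>(2) by (simp_all add: measure_space_def)
    qed simp
    also have "\<dots> = ?m E" using that by (rule \<mu>(1))
    finally show ?thesis .
  qed
  have UNIV: "indicat_real (UNIV :: 'd config set) = (\<lambda>_. 1)" by (auto simp: indicator_def)
  interpret n: prob_space \<nu>
    by (rule prob_spaceI) (simp add: space em UNIV one)
  have meas: "measure \<nu> E = a (indicat_real E)" if "E \<in> ?M" for E
    using em[OF that] pos[of "indicat_real E"] that by (simp add: measure_def)
  have asum: "a (\<lambda>\<eta>. \<Sum>i\<in>I. f i \<eta>) = (\<Sum>i\<in>I. a (f i))"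
    if "finite I" "\<And>i. i \<in> I \<Longrightarrow> cylinder_function (f i)" for I :: "real set" and f
    using that
  proof (induction I rule: finite_induct)
    case (insert i I)
    then show ?case using add[of "f i" "\<lambda>\<eta>. \<Sum>i\<in>I. f i \<eta>"] by (simp add: cylinder_sum)
  qed (simp add: a0)
  have "(\<integral>\<eta>. f \<eta> \<partial>\<nu>) = a f" if f: "cylinder_function f" for f
  proof -
    have fin: "finite (range f)" using f by (rule cylinder_finite_range)
    let ?E = "\<lambda>v. {\<eta>. f \<eta> \<in> {v}}"
    have E: "?E v \<in> ?M" for v using cylinder_event_preimage[OF f] .
    then have Em: "?E v \<in> sets \<nu>" for v using sets cylinder_event_clopen(1)[OF E] by simp
    have decomp: "f = (\<lambda>\<eta>. \<Sum>v\<in>range f. v * indicat_real (?E v) \<eta>)"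
    proof
      fix \<eta>
      have "(\<Sum>v\<in>range f. v * indicat_real (?E v) \<eta>) = (\<Sum>v\<in>range f. if v = f \<eta> then f \<eta> else 0)"
        by (rule sum.cong) (auto simp: indicator_def)
      then show "f \<eta> = (\<Sum>v\<in>range f. v * indicat_real (?E v) \<eta>)" using fin by simp
    qed
    have "(\<integral>\<eta>. f \<eta> \<partial>\<nu>) = (\<integral>\<eta>. (\<Sum>v\<in>range f. v * indicat_real (?E v) \<eta>) \<partial>\<nu>)"
      using decomp by simp
    also have "\<dots> = (\<Sum>v\<in>range f. v * measure \<nu> (?E v))"
      by (subst Bochner_Integration.integral_sum)
        (use Em in \<open>auto intro!: integrable_real_indicator simp: n.emeasure_eq_measure\<close>)
    also have "\<dots> = (\<Sum>v\<in>range f. a (\<lambda>\<eta>. v * indicat_real (?E v) \<eta>))"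
      using E by (intro sum.cong refl) (simp only: meas scale[OF E[simplified mem_Collect_eq]])
    also have "\<dots> = a (\<lambda>\<eta>. \<Sum>v\<in>range f. v * indicat_real (?E v) \<eta>)"
      using E by (intro asum[symmetric] fin) (rule cylinder_comp, simp)
    also have "\<dots> = a f" using decomp by simp
    finally show ?thesis .
  qed
  then show ?thesis
    using sets n.prob_space_axioms by (intro that[of \<nu>]) (auto simp: space_prob_algebra)
qed

section \<open>The pregenerator as a finite combination of monotone maps\<close>

text \<open>The effect of the clock of the pair \<open>(x, y)\<close> on every configuration, written so that it is
  visibly monotone; for \<open>x = y\<close> it is the identity. Letting it act on two configurations at once is the basic coupling.\<close>

definition move :: "int ^ 'd \<Rightarrow> int ^ 'd \<Rightarrow> 'd config \<Rightarrow> 'd config" where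
  "move x y \<eta> = \<eta>(x := \<eta> x \<and> \<eta> y, y := \<eta> x \<or> \<eta> y)"

lemma move_eq_exchange: "move x y \<eta> = (if \<eta> x \<and> \<not> \<eta> y then exchange \<eta> x y else \<eta>)"
  by (auto simp: move_def exchange_def fun_eq_iff)

lemma move_mono: "\<eta> \<le> \<zeta> \<Longrightarrow> move x y \<eta> \<le> move x y \<zeta>"
  by (auto simp: move_def le_fun_def)

lemma upd_mono: "\<eta> \<le> \<zeta> \<Longrightarrow> \<eta>(x := b) \<le> \<zeta>(x := b :: bool)"
  by (auto simp: le_fun_def)

lemma cylinder_move:
  assumes "cylinder_function f"
  shows "cylinder_function (\<lambda>\<eta>. f (move x y \<eta>))"
proof -
  obtain A where A: "finite A" "\<forall>\<eta> \<zeta>. (\<forall>x\<in>A. \<eta> x = \<zeta> x) \<longrightarrow> f \<eta> = f \<zeta>"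
    using assms by (auto simp: cylinder_function_def)
  show ?thesis
    by (rule cylinder_functionI[of "insert x (insert y A)"])
      (use A(1) in \<open>auto intro!: A(2)[rule_format] simp: move_def\<close>)
qed

lemma cylinder_upd:
  assumes "cylinder_function f"
  shows "cylinder_function (\<lambda>\<eta>. f (\<eta>(x := b)))"
proof -
  obtain A where A: "finite A" "\<forall>\<eta> \<zeta>. (\<forall>x\<in>A. \<eta> x = \<zeta> x) \<longrightarrow> f \<eta> = f \<zeta>"
    using assms by (auto simp: cylinder_function_def)
  show ?thesis
    by (rule cylinder_functionI[of A]) (use A(1) in \<open>auto intro!: A(2)[rule_format]\<close>)
qed

text \<open>A finite set \<open>B\<close> containing the support of \<open>f\<close> and all sites in interaction with it carries
  the whole action of the pregenerator on \<open>f\<close>.\<close>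

lemma \<Omega>_finite_form:
  assumes B: "finite B" "A \<subseteq> B" "\<And>x y. x \<in> A \<Longrightarrow> y \<notin> B \<Longrightarrow> q x y = 0 \<and> q y x = 0"
    and f: "\<And>\<eta> \<zeta>. (\<And>x. x \<in> A \<Longrightarrow> \<eta> x = \<zeta> x) \<Longrightarrow> f \<eta> = f \<zeta>"
  shows "\<Omega> q \<beta> \<delta> f \<eta> = (\<Sum>x\<in>B. \<Sum>y\<in>B. q x y * (f (move x y \<eta>) - f \<eta>)) +
    (\<Sum>x\<in>B. \<beta> x * (f (\<eta>(x := True)) - f \<eta>) + \<delta> x * (f (\<eta>(x := False)) - f \<eta>))"
proof -
  have "(\<Sum>\<^sub>\<infinity>(x, y)\<in>{(x, y). \<eta> x \<and> \<not> \<eta> y}. q x y * (f (exchange \<eta> x y) - f \<eta>))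
      = (\<Sum>\<^sub>\<infinity>(x, y)\<in>B \<times> B. q x y * (f (move x y \<eta>) - f \<eta>))"
  proof (rule infsum_cong_neutral)
    fix z assume "z \<in> B \<times> B - {(x, y). \<eta> x \<and> \<not> \<eta> y}"
    then show "(case z of (x, y) \<Rightarrow> q x y * (f (move x y \<eta>) - f \<eta>)) = 0"
      by (auto simp: move_eq_exchange split: if_splits)
  next
    fix z assume z: "z \<in> {(x, y). \<eta> x \<and> \<not> \<eta> y} - B \<times> B"
    obtain x y where xy: "z = (x, y)" by (cases z)
    have "q x y * (f (exchange \<eta> x y) - f \<eta>) = 0"
    proof (cases "x \<in> A \<or> y \<in> A")
      case True
      then have "q x y = 0" using z xy B(2) B(3)[of x y] B(3)[of y x] by auto
      then show ?thesis by simp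
    next
      case False
      then have "f (exchange \<eta> x y) = f \<eta>" by (intro f) (auto simp: exchange_def)
      then show ?thesis by simp
    qed
    then show "(case z of (x, y) \<Rightarrow> q x y * (f (exchange \<eta> x y) - f \<eta>)) = 0" by (simp add: xy)
  next
    fix z assume "z \<in> {(x, y). \<eta> x \<and> \<not> \<eta> y} \<inter> B \<times> B"
    then show "(case z of (x, y) \<Rightarrow> q x y * (f (exchange \<eta> x y) - f \<eta>)) =
      (case z of (x, y) \<Rightarrow> q x y * (f (move x y \<eta>) - f \<eta>))" by (auto simp: move_eq_exchange)
  qed
  also have "\<dots> = (\<Sum>(x, y)\<in>B \<times> B. q x y * (f (move x y \<eta>) - f \<eta>))"
    using B(1) by (intro infsum_finite) simp
  also have "\<dots> = (\<Sum>x\<in>B. \<Sum>y\<in>B. q x y * (f (move x y \<eta>) - f \<eta>))"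
    by (simp add: sum.cartesian_product)
  finally have 1: "(\<Sum>\<^sub>\<infinity>(x, y)\<in>{(x, y). \<eta> x \<and> \<not> \<eta> y}. q x y * (f (exchange \<eta> x y) - f \<eta>)) = \<dots>" .
  have "(\<Sum>\<^sub>\<infinity>x. flip_rate \<beta> \<delta> x \<eta> * (f (flip \<eta> x) - f \<eta>)) =
    (\<Sum>\<^sub>\<infinity>x\<in>B. \<beta> x * (f (\<eta>(x := True)) - f \<eta>) + \<delta> x * (f (\<eta>(x := False)) - f \<eta>))"
  proof (rule infsum_cong_neutral)
    fix x assume "x \<in> UNIV - B"
    then have "f (flip \<eta> x) = f \<eta>" using B(2) by (intro f) (auto simp: flip_def)
    then show "flip_rate \<beta> \<delta> x \<eta> * (f (flip \<eta> x) - f \<eta>) = 0" by simp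
  next
    fix x assume "x \<in> UNIV \<inter> B"
    have "\<eta>(x := True) = \<eta>" if "\<eta> x" using that by (simp add: fun_upd_idem_iff)
    moreover have "\<eta>(x := False) = \<eta>" if "\<not> \<eta> x" using that by (simp add: fun_upd_idem_iff)
    ultimately show "flip_rate \<beta> \<delta> x \<eta> * (f (flip \<eta> x) - f \<eta>) =
      \<beta> x * (f (\<eta>(x := True)) - f \<eta>) + \<delta> x * (f (\<eta>(x := False)) - f \<eta>)"
      by (auto simp: flip_rate_def flip_def)
  qed simp
  also have "\<dots> = (\<Sum>x\<in>B. \<beta> x * (f (\<eta>(x := True)) - f \<eta>) + \<delta> x * (f (\<eta>(x := False)) - f \<eta>))"
    using B(1) by (rule infsum_finite)
  finally show ?thesis unfolding \<Omega>_def 1 by simp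
qed

lemma lattice_norm_le_iff: "lattice_norm x \<le> n \<longleftrightarrow> (\<forall>i. \<bar>x $ i\<bar> \<le> n)"
  unfolding lattice_norm_def by (subst Max_le_iff) auto

lemma lattice_ball_subset:
  "{y :: int ^ 'd. lattice_norm (x - y) \<le> n} \<subseteq> vec_lambda ` (\<Pi>\<^sub>E i\<in>UNIV. {x $ i - n .. x $ i + n})"
proof
  fix y :: "int ^ 'd" assume y: "y \<in> {y. lattice_norm (x - y) \<le> n}"
  have "y $ i \<in> {x $ i - n .. x $ i + n}" for i
  proof -
    have "\<bar>x $ i - y $ i\<bar> \<le> n" using y by (simp add: lattice_norm_le_iff)
    then show ?thesis by auto
  qed
  then show "y \<in> vec_lambda ` (\<Pi>\<^sub>E i\<in>UNIV. {x $ i - n .. x $ i + n})"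
    by (intro image_eqI[of _ _ "vec_nth y"]) (auto simp: PiE_iff)
qed

lemma finite_lattice_ball: "finite {y :: int ^ 'd. lattice_norm (x - y) \<le> n}"
  by (rule finite_subset[OF lattice_ball_subset]) (intro finite_imageI finite_PiE; simp)

lemma lattice_norm_minus: "lattice_norm (x - y) = lattice_norm (y - x)"
  by (simp add: lattice_norm_def abs_minus_commute)

locale noisy_exclusion =
  fixes q :: "int ^ 'd \<Rightarrow> int ^ 'd \<Rightarrow> real" and \<beta> \<delta> :: "int ^ 'd \<Rightarrow> real"
    and P :: "real \<Rightarrow> 'd config \<Rightarrow> 'd config measure" and N :: nat
  assumes process: "noisy_exclusion_process q \<beta> \<delta> P"
    and range: "finite_range N q"
begin

lemma rates: "noisy_exclusion_rates q \<beta> \<delta>"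
  and feller: "feller_process P"
  and generator: "generator_graph P = closure (pregenerator_graph q \<beta> \<delta>)"
  using process by (auto simp: noisy_exclusion_process_def)

lemma rates_nonneg [simp]: "0 \<le> q x y" "0 \<le> \<beta> x" "0 \<le> \<delta> x"
  using rates by (auto simp: noisy_exclusion_rates_def)

lemma \<Omega>_cylinder:
  assumes "cylinder_function f" and C: "finite C"
  shows "\<exists>B. finite B \<and> C \<subseteq> B \<and>
    (\<forall>\<eta>. \<Omega> q \<beta> \<delta> f \<eta> = (\<Sum>x\<in>B. \<Sum>y\<in>B. q x y * (f (move x y \<eta>) - f \<eta>)) +
    (\<Sum>x\<in>B. \<beta> x * (f (\<eta>(x := True)) - f \<eta>) + \<delta> x * (f (\<eta>(x := False)) - f \<eta>)))"
proof -
  obtain A where A: "finite A" "\<forall>\<eta> \<zeta>. (\<forall>x\<in>A. \<eta> x = \<zeta> x) \<longrightarrow> f \<eta> = f \<zeta>"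
    using assms by (auto simp: cylinder_function_def)
  define B where "B = C \<union> A \<union> (\<Union>x\<in>A. {y. lattice_norm (x - y) \<le> int N})"
  show ?thesis
  proof (intro exI[of _ B] conjI allI)
    show "finite B" using A(1) C by (auto simp: B_def finite_lattice_ball)
    show "C \<subseteq> B" by (auto simp: B_def)
    show "\<Omega> q \<beta> \<delta> f \<eta> = (\<Sum>x\<in>B. \<Sum>y\<in>B. q x y * (f (move x y \<eta>) - f \<eta>)) +
      (\<Sum>x\<in>B. \<beta> x * (f (\<eta>(x := True)) - f \<eta>) + \<delta> x * (f (\<eta>(x := False)) - f \<eta>))" for \<eta>
    proof (rule \<Omega>_finite_form[of B A])
      fix x y assume "x \<in> A" "y \<notin> B"
      then have "lattice_norm (x - y) > int N" by (auto simp: B_def not_le)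
      then show "q x y = 0 \<and> q y x = 0"
        using range lattice_norm_minus[of x y] by (auto simp: finite_range_def)
    qed (use \<open>finite B\<close> A(2) in \<open>auto simp: B_def\<close>)
  qed
qed

lemma cylinder_\<Omega>:
  assumes "cylinder_function f"
  shows "cylinder_function (\<Omega> q \<beta> \<delta> f)"
proof -
  obtain B where B: "finite B"
    "\<forall>\<eta>. \<Omega> q \<beta> \<delta> f \<eta> = (\<Sum>x\<in>B. \<Sum>y\<in>B. q x y * (f (move x y \<eta>) - f \<eta>)) +
    (\<Sum>x\<in>B. \<beta> x * (f (\<eta>(x := True)) - f \<eta>) + \<delta> x * (f (\<eta>(x := False)) - f \<eta>))"
    using \<Omega>_cylinder[OF assms finite.emptyI] by (elim exE conjE)
  have 1: "cylinder_function (\<lambda>\<eta>. q x y * (f (move x y \<eta>) - f \<eta>))" for x y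
    by (rule cylinder_comp2[OF cylinder_move[OF assms] assms])
  have 2: "cylinder_function (\<lambda>\<eta>. \<beta> x * (f (\<eta>(x := True)) - f \<eta>) + \<delta> x * (f (\<eta>(x := False)) - f \<eta>))" for x
    by (rule cylinder_comp2[of _ _ "(+)", OF
          cylinder_comp2[OF cylinder_upd[OF assms] assms, of "\<lambda>a b. \<beta> x * (a - b)"]
          cylinder_comp2[OF cylinder_upd[OF assms] assms, of "\<lambda>a b. \<delta> x * (a - b)"]])
  have "cylinder_function (\<lambda>\<eta>. (\<Sum>x\<in>B. \<Sum>y\<in>B. q x y * (f (move x y \<eta>) - f \<eta>)) +
    (\<Sum>x\<in>B. \<beta> x * (f (\<eta>(x := True)) - f \<eta>) + \<delta> x * (f (\<eta>(x := False)) - f \<eta>)))"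
    by (rule cylinder_comp2[of _ _ "(+)", OF cylinder_sum cylinder_sum])
      (rule cylinder_sum 1 2)+
  then show ?thesis using B(2) by presburger
qed

subsection \<open>The minimum principle\<close>

text \<open>At a pair of ordered configurations where the increment \<open>f \<zeta> - f \<eta>\<close> is smallest, no
  simultaneous transition of the pair can lower it, so \<open>\<Omega> f \<zeta> - \<Omega> f \<eta> \<ge> 0\<close> there. This is the
  minimum principle for the coupled pregenerator, and it needs only functions of one configuration.\<close>

lemma \<Omega>_minimum_principle:
  assumes f: "cylinder_function f" and l: "l \<ge> 0"
    and ge: "\<And>\<eta> \<zeta>. \<eta> \<le> \<zeta> \<Longrightarrow> c \<le> (f \<zeta> - l * \<Omega> q \<beta> \<delta> f \<zeta>) - (f \<eta> - l * \<Omega> q \<beta> \<delta> f \<eta>)"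
    and le: "\<eta> \<le> \<zeta>"
  shows "c \<le> f \<zeta> - f \<eta>"
proof -
  let ?D = "{f \<zeta> - f \<eta> | \<eta> \<zeta>. \<eta> \<le> \<zeta>}"
  have "?D \<subseteq> (\<lambda>(a, b). a - b) ` (range f \<times> range f)" by auto
  then have fin: "finite ?D"
    by (rule finite_subset) (simp add: cylinder_finite_range[OF f])
  have ne: "?D \<noteq> {}" using le by blast
  obtain \<eta>0 \<zeta>0 where min: "\<eta>0 \<le> \<zeta>0" "Min ?D = f \<zeta>0 - f \<eta>0"
    using Min_in[OF fin ne] by blast
  have least: "f \<zeta>0 - f \<eta>0 \<le> f \<zeta>' - f \<eta>'" if "\<eta>' \<le> \<zeta>'" for \<eta>' \<zeta>'
    using Min_le[OF fin, of "f \<zeta>' - f \<eta>'"] that min(2) by auto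
  obtain B where B: "finite B"
    "\<forall>\<eta>. \<Omega> q \<beta> \<delta> f \<eta> = (\<Sum>x\<in>B. \<Sum>y\<in>B. q x y * (f (move x y \<eta>) - f \<eta>)) +
    (\<Sum>x\<in>B. \<beta> x * (f (\<eta>(x := True)) - f \<eta>) + \<delta> x * (f (\<eta>(x := False)) - f \<eta>))"
    using \<Omega>_cylinder[OF f finite.emptyI] by (elim exE conjE)
  have step: "r * (f \<eta>' - f \<eta>0) \<le> r * (f \<zeta>' - f \<zeta>0)" if "\<eta>' \<le> \<zeta>'" "r \<ge> 0" for \<eta>' \<zeta>' and r :: real
    using least[OF that(1)] that(2) by (intro mult_left_mono) auto
  have "\<Omega> q \<beta> \<delta> f \<eta>0 \<le> \<Omega> q \<beta> \<delta> f \<zeta>0"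
    unfolding B(2)[rule_format] by (intro add_mono sum_mono step move_mono upd_mono min(1) rates_nonneg)
  then have "l * \<Omega> q \<beta> \<delta> f \<eta>0 \<le> l * \<Omega> q \<beta> \<delta> f \<zeta>0" using l by (rule mult_left_mono)
  then have "c \<le> f \<zeta>0 - f \<eta>0" using ge[OF min(1)] by linarith
  also have "\<dots> \<le> f \<zeta> - f \<eta>" by (rule least[OF le])
  finally show ?thesis .
qed

text \<open>The principle is stable under uniform limits of \<open>f\<close> and \<open>\<Omega> f\<close> together. This is where it
  matters that the generator is the closure of the pregenerator: the functions \<open>S t f\<close>, to which the
  principle will be applied, are in general no cylinder functions.\<close>

lemma generator_minimum_principle:
  assumes fg: "(f, g) \<in> generator_graph P" and l: "l \<ge> 0"
    and ge: "\<And>\<eta> \<zeta>. \<eta> \<le> \<zeta> \<Longrightarrow> c \<le> (f \<zeta> - l * g \<zeta>) - (f \<eta> - l * g \<eta>)"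
    and le: "\<eta> \<le> \<zeta>"
  shows "c \<le> f \<zeta> - f \<eta>"
proof (rule field_le_epsilon)
  fix e :: real assume e: "e > 0"
  \<comment> \<open>Up to an error \<open>k\<close> at each point, \<open>f\<close> occurs in four values and \<open>l * g\<close> in two.\<close>
  define k where "k = e / (4 + 2 * l)"
  have k: "k > 0" "4 * k + 2 * (l * k) = e" 
  proof -
    show "k > 0" using e l by (simp add: k_def)
    have "k * (4 + 2 * l) = e" using l by (simp add: k_def)
    then show "4 * k + 2 * (l * k) = e" by (simp add: algebra_simps)
  qed
  obtain z where z: "z \<in> pregenerator_graph q \<beta> \<delta>" "dist z (f, g) < k"
    using fg k(1) unfolding generator closure_approachable by blast
  obtain f' g' where fg': "z = (f', g')" by (cases z)
  have df: "dist (f' \<xi>) (f \<xi>) \<le> k" for \<xi>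
    using dist_bounded[of f' \<xi> f] dist_fst_le[of z "(f, g)"] z(2) fg' by simp
  have dg: "dist (g' \<xi>) (g \<xi>) \<le> k" for \<xi>
    using dist_bounded[of g' \<xi> g] dist_snd_le[of z "(f, g)"] z(2) fg' by simp
  have f': "cylinder_function f'" and g': "apply_bcontfun g' = \<Omega> q \<beta> \<delta> f'"
    using z(1) fg' by (auto simp: pregenerator_graph_def)
  have "c - 2 * k - 2 * (l * k) \<le> f' \<zeta> - f' \<eta>"
  proof (rule \<Omega>_minimum_principle[OF f' l _ le])
    fix \<eta> \<zeta> :: "'d config" assume "\<eta> \<le> \<zeta>"
    note 1 = ge[OF this]
    have "l * g' \<xi> \<le> l * g \<xi> + l * k" "l * g \<xi> \<le> l * g' \<xi> + l * k" for \<xi>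
      using mult_left_mono[OF _ l, of "g' \<xi>" "g \<xi> + k"] mult_left_mono[OF _ l, of "g \<xi>" "g' \<xi> + k"] dg[of \<xi>]
      by (auto simp: dist_real_def distrib_left abs_le_iff)
    from this[of \<zeta>] this[of \<eta>] 1 df[of \<zeta>] df[of \<eta>]
    show "c - 2 * k - 2 * (l * k) \<le> f' \<zeta> - l * \<Omega> q \<beta> \<delta> f' \<zeta> - (f' \<eta> - l * \<Omega> q \<beta> \<delta> f' \<eta>)"
      unfolding g'[symmetric] dist_real_def by linarith
  qed
  then show "c \<le> f \<zeta> - f \<eta> + e"
    using df[of \<zeta>] df[of \<eta>] k(2) unfolding dist_real_def by linarith
qed

end

section \<open>The semigroup is attractive\<close>

lemma borel_measurable_config:
  fixes f :: "'d::finite config \<Rightarrow> real"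
  assumes "continuous_on UNIV f"
  shows "f \<in> borel_measurable borel"
  using assms by (rule borel_measurable_continuous_onI)

lemma continuous_integrable:
  fixes f :: "'d::finite config \<Rightarrow> real"
  assumes \<mu>: "\<mu> \<in> space (prob_algebra borel)" and f: "continuous_on UNIV f"
  shows "integrable \<mu> f"
proof -
  interpret prob_space \<mu> using \<mu> by (simp add: space_prob_algebra)
  obtain B where "\<And>\<eta>. \<bar>f \<eta>\<bar> \<le> B" using continuous_config_bounded[OF f] by auto
  moreover have "f \<in> borel_measurable \<mu>"
    using borel_measurable_config[OF f] \<mu> by (simp add: space_prob_algebra cong: measurable_cong_sets)
  ultimately show ?thesis by (intro integrable_const_bound[of _ B]) auto
qed

lemma integral_bounds:
  fixes f :: "'d::finite config \<Rightarrow> real"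
  assumes \<mu>: "\<mu> \<in> space (prob_algebra borel)" and f: "continuous_on UNIV f"
  shows "(\<And>\<eta>. f \<eta> \<le> B) \<Longrightarrow> (\<integral>\<eta>. f \<eta> \<partial>\<mu>) \<le> B" and "(\<And>\<eta>. A \<le> f \<eta>) \<Longrightarrow> A \<le> (\<integral>\<eta>. f \<eta> \<partial>\<mu>)"
proof -
  interpret prob_space \<mu> using \<mu> by (simp add: space_prob_algebra)
  note int = continuous_integrable[OF \<mu> f]
  show "(\<And>\<eta>. f \<eta> \<le> B) \<Longrightarrow> (\<integral>\<eta>. f \<eta> \<partial>\<mu>) \<le> B"
    using int by (intro integral_le_const) auto
  show "(\<And>\<eta>. A \<le> f \<eta>) \<Longrightarrow> A \<le> (\<integral>\<eta>. f \<eta> \<partial>\<mu>)"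
    using int by (intro integral_ge_const) auto
qed

context noisy_exclusion
begin

abbreviation "S \<equiv> semigroup_of P"

lemma kernel: "t \<ge> 0 \<Longrightarrow> P t \<in> borel \<rightarrow>\<^sub>M prob_algebra borel"
  using feller by (simp add: feller_process_def)

lemma law: "t \<ge> 0 \<Longrightarrow> P t \<eta> \<in> space (prob_algebra borel)"
  using measurable_space[OF kernel] by simp

lemma S_continuous: "t \<ge> 0 \<Longrightarrow> continuous_on UNIV f \<Longrightarrow> continuous_on UNIV (S t f)"
  using feller unfolding feller_process_def by blast

lemma integral_law_at:
  assumes \<mu>: "\<mu> \<in> space (prob_algebra borel)" and t: "t \<ge> 0" and f: "continuous_on UNIV f"
  shows "(\<integral>\<eta>. f \<eta> \<partial>law_at P \<mu> t) = (\<integral>\<eta>. S t f \<eta> \<partial>\<mu>)"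
proof -
  obtain B where B: "\<And>\<eta>. \<bar>f \<eta>\<bar> \<le> B" using continuous_config_bounded[OF f] by auto
  interpret prob_space \<mu> using \<mu> by (simp add: space_prob_algebra)
  have sets: "sets \<mu> = sets borel" using \<mu> by (simp add: space_prob_algebra)
  have K: "P t \<in> \<mu> \<rightarrow>\<^sub>M subprob_algebra borel"
    using measurable_prob_algebraD[OF kernel[OF t]] sets by (simp cong: measurable_cong_sets)
  have fm: "f \<in> borel_measurable borel" by (rule borel_measurable_config[OF f])
  have "(\<integral>\<eta>. f \<eta> \<partial>law_at P \<mu> t) = (\<integral>\<eta>. f \<eta> \<partial>join (distr \<mu> (subprob_algebra borel) (P t)))"
    unfolding law_at_def by (subst bind_nonempty''[OF K not_empty]) simp
  also have "\<dots> = (\<integral>M. (\<integral>\<eta>. f \<eta> \<partial>M) \<partial>distr \<mu> (subprob_algebra borel) (P t))"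
  proof (rule integral_join[OF fm, of B _ 1])
    show "finite_measure (distr \<mu> (subprob_algebra borel) (P t))"
      using K by (intro finite_measure_distr) auto
    have "emeasure (P t \<eta>) (space (P t \<eta>)) \<le> 1" for \<eta>
      using law[OF t, of \<eta>] by (simp add: space_prob_algebra prob_space.emeasure_space_1)
    then show "AE M in distr \<mu> (subprob_algebra borel) (P t). emeasure M (space M) \<le> ennreal 1"
      by (intro AE_distr_iff[THEN iffD2, OF K] AE_I2)
        (auto simp: subprob_space.subprob_emeasure_le_1 space_subprob_algebra
          intro!: predE pred_le_const)
  qed (use B in auto)
  also have "\<dots> = (\<integral>\<eta>. S t f \<eta> \<partial>\<mu>)"
    unfolding semigroup_of_def
    by (rule integral_distr[OF K]) (rule integral_measurable_subprob_algebra[OF fm])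
  finally show ?thesis .
qed

lemma S_add_time:
  assumes "s \<ge> 0" "t \<ge> 0" "continuous_on UNIV f"
  shows "S (s + t) f \<eta> = S s (S t f) \<eta>"
proof -
  have "P (s + t) \<eta> = law_at P (P s \<eta>) t"
    using feller assms unfolding feller_process_def law_at_def by blast
  then show ?thesis
    using integral_law_at[OF law[OF assms(1)] assms(2,3), of \<eta>] by (simp add: semigroup_of_def)
qed

lemma S_0: "continuous_on UNIV f \<Longrightarrow> S 0 f \<eta> = f \<eta>"
  using feller unfolding feller_process_def semigroup_of_def
  by (simp add: integral_return borel_measurable_config)

lemma S_add:
  assumes "t \<ge> 0" "continuous_on UNIV f" "continuous_on UNIV g"
  shows "S t (\<lambda>\<eta>. f \<eta> + g \<eta>) \<eta> = S t f \<eta> + S t g \<eta>"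
  using assms unfolding semigroup_of_def
  by (intro Bochner_Integration.integral_add continuous_integrable law)

lemma S_diff:
  assumes "t \<ge> 0" "continuous_on UNIV f" "continuous_on UNIV g"
  shows "S t (\<lambda>\<eta>. f \<eta> - g \<eta>) \<eta> = S t f \<eta> - S t g \<eta>"
  using assms unfolding semigroup_of_def
  by (intro Bochner_Integration.integral_diff continuous_integrable law)

lemma S_scale: "S t (\<lambda>\<eta>. c * f \<eta>) \<eta> = c * S t f \<eta>"
  unfolding semigroup_of_def by simp

lemma S_bounds:
  assumes "t \<ge> 0" "continuous_on UNIV f"
  shows "(\<And>\<eta>. f \<eta> \<le> B) \<Longrightarrow> S t f \<eta> \<le> B" and "(\<And>\<eta>. A \<le> f \<eta>) \<Longrightarrow> A \<le> S t f \<eta>"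
  using integral_bounds[OF law[OF assms(1)] assms(2)] unfolding semigroup_of_def by blast+

lemma S_abs_le:
  assumes "t \<ge> 0" "continuous_on UNIV f" "\<And>\<eta>. \<bar>f \<eta>\<bar> \<le> B"
  shows "\<bar>S t f \<eta>\<bar> \<le> B"
proof -
  have "f \<eta> \<le> B" "- B \<le> f \<eta>" for \<eta> using assms(3)[of \<eta>] by auto
  then have "S t f \<eta> \<le> B" "- B \<le> S t f \<eta>"
    using S_bounds(1)[OF assms(1,2)] S_bounds(2)[OF assms(1,2)] by auto
  then show ?thesis by auto
qed

lemma apply_Bcontfun:
  fixes f :: "'d config \<Rightarrow> real"
  assumes "continuous_on UNIV f"
  shows "apply_bcontfun (Bcontfun f) = f"
proof -
  obtain B where "\<And>\<eta>. \<bar>f \<eta>\<bar> \<le> B" using continuous_config_bounded[OF assms] by auto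
  then have "f \<in> bcontfun" using assms by (intro bcontfun_normI) auto
  then show ?thesis by (rule Bcontfun_inverse)
qed

text \<open>The two first-order estimates on which the Euler scheme below rests, for a cylinder function
  and uniformly in the configuration.\<close>

lemma S_first_order:
  assumes f: "cylinder_function f" and e: "e > 0"
  obtains d where "d > 0"
    "\<And>h \<eta>. 0 < h \<Longrightarrow> h < d \<Longrightarrow> \<bar>S h f \<eta> - f \<eta> - h * \<Omega> q \<beta> \<delta> f \<eta>\<bar> \<le> e * h"
    "\<And>h \<eta>. 0 < h \<Longrightarrow> h < d \<Longrightarrow> \<bar>S h (\<Omega> q \<beta> \<delta> f) \<eta> - \<Omega> q \<beta> \<delta> f \<eta>\<bar> \<le> e"
proof -
  have cf: "continuous_on UNIV f" by (rule cylinder_continuous[OF f])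
  have cg: "continuous_on UNIV (\<Omega> q \<beta> \<delta> f)" by (rule cylinder_continuous[OF cylinder_\<Omega>[OF f]])
  have "(Bcontfun f, Bcontfun (\<Omega> q \<beta> \<delta> f)) \<in> pregenerator_graph q \<beta> \<delta>"
    using f by (simp add: pregenerator_graph_def apply_Bcontfun cf cg)
  then have "(Bcontfun f, Bcontfun (\<Omega> q \<beta> \<delta> f)) \<in> generator_graph P"
    unfolding generator using closure_subset by blast
  then have "uniform_limit UNIV (\<lambda>t \<eta>. (S t f \<eta> - f \<eta>) / t) (\<Omega> q \<beta> \<delta> f) (at_right 0)"
    by (simp add: generator_graph_def apply_Bcontfun cf cg)
  then have "\<forall>\<^sub>F t in at_right 0. \<forall>\<eta>\<in>UNIV. dist ((S t f \<eta> - f \<eta>) / t) (\<Omega> q \<beta> \<delta> f \<eta>) < e"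
    by (rule uniform_limitD[OF _ e])
  moreover have "uniform_limit UNIV (\<lambda>t. S t (\<Omega> q \<beta> \<delta> f)) (\<Omega> q \<beta> \<delta> f) (at_right 0)"
    using feller cg unfolding feller_process_def by blast
  then have "\<forall>\<^sub>F t in at_right 0. \<forall>\<eta>\<in>UNIV. dist (S t (\<Omega> q \<beta> \<delta> f) \<eta>) (\<Omega> q \<beta> \<delta> f \<eta>) < e"
    by (rule uniform_limitD[OF _ e])
  ultimately have "\<forall>\<^sub>F t in at_right 0. (\<forall>\<eta>. dist ((S t f \<eta> - f \<eta>) / t) (\<Omega> q \<beta> \<delta> f \<eta>) < e) \<and>
      (\<forall>\<eta>. dist (S t (\<Omega> q \<beta> \<delta> f) \<eta>) (\<Omega> q \<beta> \<delta> f \<eta>) < e)"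
    by eventually_elim simp
  then obtain d where d: "d > 0"
    "\<And>t \<eta>. 0 < t \<Longrightarrow> t < d \<Longrightarrow> dist ((S t f \<eta> - f \<eta>) / t) (\<Omega> q \<beta> \<delta> f \<eta>) < e"
    "\<And>t \<eta>. 0 < t \<Longrightarrow> t < d \<Longrightarrow> dist (S t (\<Omega> q \<beta> \<delta> f) \<eta>) (\<Omega> q \<beta> \<delta> f \<eta>) < e"
    by (auto simp: eventually_at_right_field)
  show ?thesis
  proof (rule that[OF d(1)])
    fix h \<eta> assume h: "0 < h" "h < d"
    have "S h f \<eta> - f \<eta> - h * \<Omega> q \<beta> \<delta> f \<eta> = ((S h f \<eta> - f \<eta>) / h - \<Omega> q \<beta> \<delta> f \<eta>) * h"
      using h by (simp add: field_simps)
    also have "\<bar>\<dots>\<bar> \<le> e * h"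
      using d(2)[OF h, of \<eta>] h by (simp add: abs_mult dist_real_def)
    finally show "\<bar>S h f \<eta> - f \<eta> - h * \<Omega> q \<beta> \<delta> f \<eta>\<bar> \<le> e * h" .
    show "\<bar>S h (\<Omega> q \<beta> \<delta> f) \<eta> - \<Omega> q \<beta> \<delta> f \<eta>\<bar> \<le> e"
      using d(3)[OF h, of \<eta>] by (simp add: dist_real_def)
  qed
qed

text \<open>The difference quotient of \<open>S t f\<close> is the image of that of \<open>f\<close> under \<open>S t\<close>, a contraction that
  commutes with all \<open>S h\<close>.\<close>

lemma S_in_generator_graph:
  assumes f: "cylinder_function f" and t: "t \<ge> 0"
  shows "(Bcontfun (S t f), Bcontfun (S t (\<Omega> q \<beta> \<delta> f))) \<in> generator_graph P"
proof -
  have cf: "continuous_on UNIV f" by (rule cylinder_continuous[OF f])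
  have cg: "continuous_on UNIV (\<Omega> q \<beta> \<delta> f)" by (rule cylinder_continuous[OF cylinder_\<Omega>[OF f]])
  note cS = S_continuous[OF t cf] S_continuous[OF t cg]
  have "uniform_limit UNIV (\<lambda>h \<eta>. (S h (S t f) \<eta> - S t f \<eta>) / h) (S t (\<Omega> q \<beta> \<delta> f)) (at_right 0)"
  proof (rule uniform_limitI)
    fix e :: real assume e: "e > 0"
    then have "e / 2 > 0" by simp
    from S_first_order[OF f this] obtain d where d: "d > 0"
      "\<And>h \<eta>. 0 < h \<Longrightarrow> h < d \<Longrightarrow> \<bar>S h f \<eta> - f \<eta> - h * \<Omega> q \<beta> \<delta> f \<eta>\<bar> \<le> e / 2 * h"
      by metis
    have "dist ((S h (S t f) \<eta> - S t f \<eta>) / h) (S t (\<Omega> q \<beta> \<delta> f) \<eta>) < e" if h: "0 < h" "h < d" for h \<eta>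
    proof -
      have ch: "continuous_on UNIV (S h f)" using h cf by (intro S_continuous) auto
      have "S h (S t f) \<eta> = S t (S h f) \<eta>"
        using S_add_time[of h t f \<eta>] S_add_time[of t h f \<eta>] h t cf by (simp add: add.commute)
      then have "S h (S t f) \<eta> - S t f \<eta> - h * S t (\<Omega> q \<beta> \<delta> f) \<eta>
          = S t (\<lambda>\<eta>. S h f \<eta> - f \<eta> - h * \<Omega> q \<beta> \<delta> f \<eta>) \<eta>"
        using t cf cg ch by (simp add: S_diff S_scale continuous_on_diff continuous_on_mult_left)
      also have "\<bar>\<dots>\<bar> \<le> e / 2 * h"
        using t d(2)[OF h] cf cg ch by (intro S_abs_le continuous_intros) auto
      finally have *: "\<bar>S h (S t f) \<eta> - S t f \<eta> - h * S t (\<Omega> q \<beta> \<delta> f) \<eta>\<bar> \<le> e / 2 * h" .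
      have "(S h (S t f) \<eta> - S t f \<eta>) / h - S t (\<Omega> q \<beta> \<delta> f) \<eta> =
        (S h (S t f) \<eta> - S t f \<eta> - h * S t (\<Omega> q \<beta> \<delta> f) \<eta>) / h"
        using h by (simp add: field_simps)
      also have "\<bar>\<dots>\<bar> \<le> e / 2" using * h by (simp add: divide_le_eq)
      also have "\<dots> < e" using e by simp
      finally show ?thesis by (simp add: dist_real_def)
    qed
    then show "\<forall>\<^sub>F h in at_right 0. \<forall>\<eta>\<in>UNIV. dist ((S h (S t f) \<eta> - S t f \<eta>) / h) (S t (\<Omega> q \<beta> \<delta> f) \<eta>) < e"
      using d(1) by (auto simp: eventually_at_right_field)
  qed
  then show ?thesis by (simp add: generator_graph_def apply_Bcontfun cS)
qed

text \<open>One implicit Euler step costs at most \<open>o(h)\<close>, uniformly in time, because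
  \<open>S (t + h) f - h S (t + h) (\<Omega> f)\<close> and \<open>S t f\<close> differ by the image under the contraction \<open>S t\<close>
  of a fixed \<open>o(h)\<close> function; and the minimum principle says that a step creates no negative
  increments of its own. Summing over \<open>t / h\<close> steps shows that monotonicity is preserved.\<close>

theorem S_attractive:
  assumes f: "cylinder_function f" "mono f" and t: "t \<ge> 0"
  shows "mono (S t f)"
proof (cases "t = 0")
  case True
  then show ?thesis using S_0[OF cylinder_continuous[OF f(1)]] f(2) by (simp add: mono_def)
next
  case False
  then have t: "t > 0" using t by simp
  have cf: "continuous_on UNIV f" by (rule cylinder_continuous[OF f(1)])
  have cg: "continuous_on UNIV (\<Omega> q \<beta> \<delta> f)" by (rule cylinder_continuous[OF cylinder_\<Omega>[OF f(1)]])
  show ?thesis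
  proof (rule monoI)
    fix \<eta> \<zeta> :: "'d config" assume le: "\<eta> \<le> \<zeta>"
    show "S t f \<eta> \<le> S t f \<zeta>"
    proof (rule field_le_epsilon)
      fix e' :: real assume e': "e' > 0"
      \<comment> \<open>An Euler step of length \<open>h\<close> costs \<open>2 * (e * h)\<close> at each of the two configurations.\<close>
      define e where "e = e' / (4 * t)"
      have e: "e > 0" "4 * (e * t) = e'" using e' t by (simp_all add: e_def)
      obtain d where d: "d > 0"
        "\<And>h \<eta>. 0 < h \<Longrightarrow> h < d \<Longrightarrow> \<bar>S h f \<eta> - f \<eta> - h * \<Omega> q \<beta> \<delta> f \<eta>\<bar> \<le> e * h"
        "\<And>h \<eta>. 0 < h \<Longrightarrow> h < d \<Longrightarrow> \<bar>S h (\<Omega> q \<beta> \<delta> f) \<eta> - \<Omega> q \<beta> \<delta> f \<eta>\<bar> \<le> e"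
        using S_first_order[OF f(1) e(1)] by metis
      obtain n :: nat where n: "t / d < n" using reals_Archimedean2 by blast
      have n0: "0 < n" using n t d(1) by (metis divide_pos_pos less_trans of_nat_0_less_iff)
      define h where "h = t / n"
      have h: "0 < h" "h < d" "h * n = t"
        using n n0 t d(1) by (simp_all add: h_def field_simps)
      have ch: "continuous_on UNIV (S h f)" "continuous_on UNIV (S h (\<Omega> q \<beta> \<delta> f))"
        using h cf cg by (auto intro!: S_continuous)
      have euler: "\<bar>S (s + h) f \<xi> - h * S (s + h) (\<Omega> q \<beta> \<delta> f) \<xi> - S s f \<xi>\<bar> \<le> 2 * (e * h)"
        if s: "s \<ge> 0" for s \<xi>
      proof -
        let ?r = "\<lambda>\<eta>. S h f \<eta> - f \<eta> - h * S h (\<Omega> q \<beta> \<delta> f) \<eta>"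
        have r: "\<bar>?r \<eta>\<bar> \<le> 2 * (e * h)" for \<eta>
        proof -
          have "\<bar>h * S h (\<Omega> q \<beta> \<delta> f) \<eta> - h * \<Omega> q \<beta> \<delta> f \<eta>\<bar> \<le> h * e"
            using d(3)[OF h(1,2), of \<eta>] h(1)
            by (simp add: abs_mult flip: right_diff_distrib)
          then show ?thesis using d(2)[OF h(1,2), of \<eta>] by (simp add: mult.commute)
        qed
        have "S (s + h) f \<xi> - h * S (s + h) (\<Omega> q \<beta> \<delta> f) \<xi> - S s f \<xi> = S s ?r \<xi>"
          using s h(1) cf cg ch
          by (simp add: S_add_time S_diff S_scale continuous_on_diff continuous_on_mult_left)
        also have "\<bar>\<dots>\<bar> \<le> 2 * (e * h)"
          using s r cf cg ch by (intro S_abs_le continuous_intros) auto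
        finally show ?thesis .
      qed
      have "- (real k * (4 * (e * h))) \<le> S (k * h) f \<zeta>' - S (k * h) f \<eta>'" if "\<eta>' \<le> \<zeta>'" for k :: nat and \<eta>' \<zeta>'
        using that
      proof (induction k arbitrary: \<eta>' \<zeta>')
        case 0
        then show ?case using f(2) S_0[OF cf] by (simp add: mono_def)
      next
        case (Suc k)
        let ?s = "real k * h" and ?s' = "real (Suc k) * h"
        have s: "?s \<ge> 0" "?s' \<ge> 0" "?s' = ?s + h" using h(1) by (simp_all add: algebra_simps)
        have cs: "continuous_on UNIV (S ?s' f)" "continuous_on UNIV (S ?s' (\<Omega> q \<beta> \<delta> f))"
          using S_continuous[OF s(2) cf] S_continuous[OF s(2) cg] .
        have inc: "- (real (Suc k) * (4 * (e * h))) \<le>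
            S ?s' f \<zeta> - h * S ?s' (\<Omega> q \<beta> \<delta> f) \<zeta> - (S ?s' f \<eta> - h * S ?s' (\<Omega> q \<beta> \<delta> f) \<eta>)"
          if "\<eta> \<le> \<zeta>" for \<eta> \<zeta>
          using Suc.IH[OF that] euler[OF s(1), of \<eta>] euler[OF s(1), of \<zeta>]
          unfolding s(3)[symmetric] by (simp add: distrib_right)
        have "- (real (Suc k) * (4 * (e * h))) \<le> Bcontfun (S ?s' f) \<zeta>' - Bcontfun (S ?s' f) \<eta>'"
          by (rule generator_minimum_principle[OF S_in_generator_graph[OF f(1) s(2)], of h])
            (use h(1) inc Suc.prems in \<open>simp_all only: apply_Bcontfun cs less_imp_le\<close>)
        then show ?case by (simp only: apply_Bcontfun cs)
      qed
      from this[OF le, of n] have "- (n * (4 * (e * h))) \<le> S (n * h) f \<zeta> - S (n * h) f \<eta>" .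
      moreover have "n * (4 * (e * h)) = 4 * (e * (h * n))" by simp
      then have "n * (4 * (e * h)) = e'" by (simp only: h(3) e(2))
      moreover have "n * h = t" using h(3) by (simp add: mult.commute)
      ultimately show "S t f \<eta> \<le> S t f \<zeta> + e'" by simp
    qed
  qed
qed

end

section \<open>The discrepancy functional\<close>

text \<open>A cylinder function changes only if one of finitely many sites does. The number of
  particles on these sites then grows by at least one along an increasing pair, so a large multiple
  of it compensates any decrease. In this way facts about monotone cylinder functions extend to all
  cylinder functions.\<close>

lemma cylinder_mono_compensation:
  fixes f :: "'d::finite config \<Rightarrow> real"
  assumes "cylinder_function f"
  obtains A c where "finite A" "c \<ge> 0"
    "mono (\<lambda>\<eta>. c * (\<Sum>x\<in>A. of_bool (\<eta> x)) + f \<eta>)" "mono (\<lambda>\<eta>. c * (\<Sum>x\<in>A. of_bool (\<eta> x)) - f \<eta>)"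
proof -
  obtain A where A: "finite A" "\<forall>\<eta> \<zeta>. (\<forall>x\<in>A. \<eta> x = \<zeta> x) \<longrightarrow> f \<eta> = f \<zeta>"
    using assms by (auto simp: cylinder_function_def)
  obtain B where B: "\<And>\<eta>. \<bar>f \<eta>\<bar> \<le> B" "B > 0"
    using continuous_config_bounded[OF cylinder_continuous[OF assms]] by metis
  have *: "\<bar>f \<zeta> - f \<eta>\<bar> \<le> 2 * B * (\<Sum>x\<in>A. of_bool (\<zeta> x)) - 2 * B * (\<Sum>x\<in>A. of_bool (\<eta> x))"
    if le: "\<eta> \<le> \<zeta>" for \<eta> \<zeta>
  proof (cases "\<forall>x\<in>A. \<eta> x = \<zeta> x")
    case True
    then have "f \<eta> = f \<zeta>" using A(2) by blast
    moreover have "(\<Sum>x\<in>A. of_bool (\<zeta> x)) = (\<Sum>x\<in>A. of_bool (\<eta> x) :: real)"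
      using True by (intro sum.cong) auto
    ultimately show ?thesis by simp
  next
    case False
    then obtain z where z: "z \<in> A" "\<eta> z \<noteq> \<zeta> z" by blast
    have "(\<Sum>x\<in>A. if x = z then 1 else 0) \<le> (\<Sum>x\<in>A. of_bool (\<zeta> x) - of_bool (\<eta> x) :: real)"
      using le z(2) by (intro sum_mono) (auto simp: le_fun_def)
    then have "1 \<le> (\<Sum>x\<in>A. of_bool (\<zeta> x) - of_bool (\<eta> x) :: real)"
      using A(1) z(1) by simp
    then have "2 * B * 1 \<le> 2 * B * (\<Sum>x\<in>A. of_bool (\<zeta> x) - of_bool (\<eta> x) :: real)"
      using B(2) by (intro mult_left_mono) auto
    also have "\<dots> = 2 * B * (\<Sum>x\<in>A. of_bool (\<zeta> x)) - 2 * B * (\<Sum>x\<in>A. of_bool (\<eta> x))"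
      by (simp only: sum_subtractf right_diff_distrib)
    finally show ?thesis using B(1)[of \<eta>] B(1)[of \<zeta>] by linarith
  qed
  show ?thesis
  proof (rule that[OF A(1), of "2 * B"])
    show "0 \<le> 2 * B" using B(2) by simp
    show "mono (\<lambda>\<eta>. 2 * B * (\<Sum>x\<in>A. of_bool (\<eta> x)) + f \<eta>)"
    proof (rule monoI)
      fix \<eta> \<zeta> :: "'d config" assume "\<eta> \<le> \<zeta>"
      then show "2 * B * (\<Sum>x\<in>A. of_bool (\<eta> x)) + f \<eta> \<le> 2 * B * (\<Sum>x\<in>A. of_bool (\<zeta> x)) + f \<zeta>"
        using *[of \<eta> \<zeta>] by linarith
    qed
    show "mono (\<lambda>\<eta>. 2 * B * (\<Sum>x\<in>A. of_bool (\<eta> x)) - f \<eta>)"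
    proof (rule monoI)
      fix \<eta> \<zeta> :: "'d config" assume "\<eta> \<le> \<zeta>"
      then show "2 * B * (\<Sum>x\<in>A. of_bool (\<eta> x)) - f \<eta> \<le> 2 * B * (\<Sum>x\<in>A. of_bool (\<zeta> x)) - f \<zeta>"
        using *[of \<eta> \<zeta>] by linarith
    qed
  qed
qed

lemma cylinder_weighted_sites:
  "cylinder_function (\<lambda>\<eta>. c * (\<Sum>x\<in>A. of_bool (\<eta> x)))"
  by (rule cylinder_comp[OF cylinder_sum]) simp

lemma mono_weighted_sites:
  "c \<ge> 0 \<Longrightarrow> mono (\<lambda>\<eta>. c * (\<Sum>x\<in>A. of_bool (\<eta> x)) :: real)"
  by (intro monoI mult_left_mono sum_mono) (auto simp: le_fun_def)

context noisy_exclusion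
begin

definition lo :: "('d config \<Rightarrow> real) \<Rightarrow> real" where
  "lo f = Lim at_top (\<lambda>t. S t f bot)"

definition hi :: "('d config \<Rightarrow> real) \<Rightarrow> real" where
  "hi f = Lim at_top (\<lambda>t. S t f top)"

text \<open>In any monotone coupling of the two limiting laws this is the expected increment of \<open>f\<close>.\<close>

definition gap :: "('d config \<Rightarrow> real) \<Rightarrow> real" where
  "gap f = hi f - lo f"

text \<open>By attractiveness, \<open>S (t' - t)\<close> applied to the monotone function \<open>S t f\<close> can only raise its
  value at the empty configuration and lower it at the full one.\<close>

lemma mono_cylinder_limits:
  assumes f: "cylinder_function f" "mono f"
  shows "\<exists>l. ((\<lambda>t. S t f bot) \<longlongrightarrow> l) at_top" "\<exists>l. ((\<lambda>t. S t f top) \<longlongrightarrow> l) at_top"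
proof -
  have cf: "continuous_on UNIV f" by (rule cylinder_continuous[OF f(1)])
  obtain B where "\<And>\<eta>. \<bar>f \<eta>\<bar> \<le> B" using continuous_config_bounded[OF cf] by auto
  then have B: "\<bar>S t f \<eta>\<bar> \<le> B" if "t \<ge> 0" for t \<eta> using that by (intro S_abs_le cf)
  have step: "S t f bot \<le> S t' f bot" "S t' f top \<le> S t f top" if "0 \<le> t" "t \<le> t'" for t t'
  proof -
    have ct: "continuous_on UNIV (S t f)" using that(1) cf by (rule S_continuous)
    have m: "mono (S t f)" using f that(1) by (intro S_attractive)
    have eq: "S t' f \<eta> = S (t' - t) (S t f) \<eta>" for \<eta>
      using S_add_time[of "t' - t" t f \<eta>] that cf by simp
    show "S t f bot \<le> S t' f bot"
      unfolding eq using that by (intro S_bounds(2)[OF _ ct] monoD[OF m]) auto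
    show "S t' f top \<le> S t f top"
      unfolding eq using that by (intro S_bounds(1)[OF _ ct] monoD[OF m]) auto
  qed
  have bdd: "bdd_above ((\<lambda>t. S t f bot) ` {0..})" "bdd_below ((\<lambda>t. S t f top) ` {0..})"
    using B[THEN abs_le_D1] B[THEN abs_le_D2]
    by (auto intro!: bdd_aboveI2[of _ _ B] bdd_belowI2[of _ "- B"] simp: minus_le_iff)
  have "((\<lambda>t. S t f bot) \<longlongrightarrow> (SUP t\<in>{0..}. S t f bot)) at_top"
  proof (rule increasing_tendsto)
    show "\<forall>\<^sub>F t in at_top. S t f bot \<le> (SUP t\<in>{0..}. S t f bot)"
      using eventually_ge_at_top[of 0] by eventually_elim (intro cSUP_upper bdd, simp)
    fix v assume "v < (SUP t\<in>{0..}. S t f bot)"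
    then obtain t where t: "t \<ge> 0" "v < S t f bot"
      using less_cSUP_iff[OF _ bdd(1)] by auto
    show "\<forall>\<^sub>F t in at_top. v < S t f bot"
      using eventually_ge_at_top[of t] by eventually_elim (rule less_le_trans[OF t(2) step(1)[OF t(1)]])
  qed
  then show "\<exists>l. ((\<lambda>t. S t f bot) \<longlongrightarrow> l) at_top" by blast
  have "((\<lambda>t. S t f top) \<longlongrightarrow> (INF t\<in>{0..}. S t f top)) at_top"
  proof (rule decreasing_tendsto)
    show "\<forall>\<^sub>F t in at_top. (INF t\<in>{0..}. S t f top) \<le> S t f top"
      using eventually_ge_at_top[of 0] by eventually_elim (intro cINF_lower bdd, simp)
    fix v assume "(INF t\<in>{0..}. S t f top) < v"
    then obtain t where t: "t \<ge> 0" "S t f top < v"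
      using cINF_less_iff[OF _ bdd(2)] by auto
    show "\<forall>\<^sub>F t in at_top. S t f top < v"
      using eventually_ge_at_top[of t] by eventually_elim (rule le_less_trans[OF step(2)[OF t(1)] t(2)])
  qed
  then show "\<exists>l. ((\<lambda>t. S t f top) \<longlongrightarrow> l) at_top" by blast
qed

lemma lo_hi_tendsto:
  assumes f: "cylinder_function f"
  shows "((\<lambda>t. S t f bot) \<longlongrightarrow> lo f) at_top" "((\<lambda>t. S t f top) \<longlongrightarrow> hi f) at_top"
proof -
  obtain A c where A: "finite A" "c \<ge> 0" "mono (\<lambda>\<eta>. c * (\<Sum>x\<in>A. of_bool (\<eta> x)) + f \<eta>)"
    by (rule cylinder_mono_compensation[OF f]) (rule that)
  define g where "g = (\<lambda>\<eta>. c * (\<Sum>x\<in>A. of_bool (\<eta> x)) :: real)"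
  have g: "cylinder_function g" "mono g" and gf: "cylinder_function (\<lambda>\<eta>. g \<eta> + f \<eta>)" "mono (\<lambda>\<eta>. g \<eta> + f \<eta>)"
    using A(2,3) mono_weighted_sites cylinder_weighted_sites cylinder_comp2[OF _ f, of g "(+)"]
    by (auto simp: g_def)
  have eq: "S t f \<eta> = S t (\<lambda>\<eta>. g \<eta> + f \<eta>) \<eta> - S t g \<eta>" if "t \<ge> 0" for t \<eta>
    using S_add[OF that cylinder_continuous[OF g(1)] cylinder_continuous[OF f]] by simp
  have *: "((\<lambda>t. S t f \<eta>) \<longlongrightarrow> Lim at_top (\<lambda>t. S t f \<eta>)) at_top"
    if lim: "\<And>f. cylinder_function f \<Longrightarrow> mono f \<Longrightarrow> \<exists>l. ((\<lambda>t. S t f \<eta>) \<longlongrightarrow> l) at_top" for \<eta>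
  proof -
    obtain l1 l2 where "((\<lambda>t. S t (\<lambda>\<eta>. g \<eta> + f \<eta>) \<eta>) \<longlongrightarrow> l1) at_top" "((\<lambda>t. S t g \<eta>) \<longlongrightarrow> l2) at_top"
      using lim[OF gf] lim[OF g] by (elim exE)
    then have "((\<lambda>t. S t (\<lambda>\<eta>. g \<eta> + f \<eta>) \<eta> - S t g \<eta>) \<longlongrightarrow> l1 - l2) at_top"
      by (rule tendsto_diff)
    then have "((\<lambda>t. S t f \<eta>) \<longlongrightarrow> l1 - l2) at_top"
      by (rule Lim_transform_eventually)
        (use eventually_ge_at_top[of 0] in eventually_elim, use eq in simp)
    then show ?thesis by (simp add: tendsto_Lim)
  qed
  show "((\<lambda>t. S t f bot) \<longlongrightarrow> lo f) at_top" "((\<lambda>t. S t f top) \<longlongrightarrow> hi f) at_top"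
    unfolding lo_def hi_def by (intro * mono_cylinder_limits; assumption)+
qed

lemma gap_tendsto:
  assumes "cylinder_function f"
  shows "((\<lambda>t. S t f top - S t f bot) \<longlongrightarrow> gap f) at_top"
  unfolding gap_def by (intro tendsto_diff lo_hi_tendsto assms)

lemma gap_add:
  assumes "cylinder_function f" "cylinder_function g"
  shows "gap (\<lambda>\<eta>. f \<eta> + g \<eta>) = gap f + gap g"
proof (rule tendsto_unique[OF _ gap_tendsto])
  show "cylinder_function (\<lambda>\<eta>. f \<eta> + g \<eta>)" using cylinder_comp2[OF assms] .
  have "((\<lambda>t. (S t f top - S t f bot) + (S t g top - S t g bot)) \<longlongrightarrow> gap f + gap g) at_top"
    by (intro tendsto_add gap_tendsto assms)
  then show "((\<lambda>t. S t (\<lambda>\<eta>. f \<eta> + g \<eta>) top - S t (\<lambda>\<eta>. f \<eta> + g \<eta>) bot) \<longlongrightarrow> gap f + gap g) at_top"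
    by (rule Lim_transform_eventually)
      (use eventually_ge_at_top[of 0] in eventually_elim,
       use S_add cylinder_continuous[OF assms(1)] cylinder_continuous[OF assms(2)] in simp)
qed simp

lemma gap_scale:
  assumes "cylinder_function f"
  shows "gap (\<lambda>\<eta>. c * f \<eta>) = c * gap f"
proof (rule tendsto_unique[OF _ gap_tendsto])
  show "cylinder_function (\<lambda>\<eta>. c * f \<eta>)" using cylinder_comp[OF assms] .
  have "((\<lambda>t. c * (S t f top - S t f bot)) \<longlongrightarrow> c * gap f) at_top"
    by (intro tendsto_mult_left gap_tendsto assms)
  then show "((\<lambda>t. S t (\<lambda>\<eta>. c * f \<eta>) top - S t (\<lambda>\<eta>. c * f \<eta>) bot) \<longlongrightarrow> c * gap f) at_top"
    by (simp add: S_scale right_diff_distrib)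
qed simp

lemma gap_diff:
  assumes "cylinder_function f" "cylinder_function g"
  shows "gap (\<lambda>\<eta>. f \<eta> - g \<eta>) = gap f - gap g"
  using gap_add[OF assms(1) cylinder_comp[OF assms(2), of "(*) (-1)"]] gap_scale[OF assms(2), of "-1"]
  by simp

lemma gap_sum:
  assumes "\<And>i. i \<in> I \<Longrightarrow> cylinder_function (f i)"
  shows "gap (\<lambda>\<eta>. \<Sum>i\<in>I. f i \<eta>) = (\<Sum>i\<in>I. gap (f i))"
proof -
  have 0: "gap (\<lambda>_. 0) = 0" using gap_scale[of "\<lambda>_. 0" 0] by simp
  show ?thesis using assms
  proof (induction I rule: infinite_finite_induct)
    case (insert i I)
    then show ?case using gap_add[of "f i" "\<lambda>\<eta>. \<Sum>i\<in>I. f i \<eta>"] by (simp add: cylinder_sum)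
  qed (simp_all add: 0)
qed

lemma gap_nonneg:
  assumes "cylinder_function f" "mono f"
  shows "gap f \<ge> 0"
proof (rule tendsto_lowerbound[OF gap_tendsto[OF assms(1)]])
  show "\<forall>\<^sub>F t in at_top. 0 \<le> S t f top - S t f bot"
    using eventually_ge_at_top[of 0]
  proof eventually_elim
    case (elim t)
    have "S t f bot \<le> S t f top" by (rule monoD[OF S_attractive[OF assms elim] bot_least])
    then show ?case by simp
  qed
qed simp

lemma gap_mono:
  assumes "cylinder_function f" "cylinder_function g" "mono (\<lambda>\<eta>. g \<eta> - f \<eta>)"
  shows "gap f \<le> gap g"
  using gap_nonneg[OF cylinder_comp2[OF assms(2,1), of "(-)"] assms(3)] gap_diff[OF assms(2,1)] by simp

text \<open>The functional is invariant under the dynamics, because a function of time that converges and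
  whose increments over a fixed time \<open>h\<close> are \<open>h S t (\<Omega> f) + o(h)\<close> forces the limit of
  \<open>S t (\<Omega> f)\<close> to vanish.\<close>

lemma gap_\<Omega>:
  assumes f: "cylinder_function f"
  shows "gap (\<Omega> q \<beta> \<delta> f) = 0"
proof -
  have cf: "continuous_on UNIV f" by (rule cylinder_continuous[OF f])
  have cg: "continuous_on UNIV (\<Omega> q \<beta> \<delta> f)" by (rule cylinder_continuous[OF cylinder_\<Omega>[OF f]])
  have *: "l' = 0" if l: "((\<lambda>t. S t f \<eta>) \<longlongrightarrow> l) at_top" and l': "((\<lambda>t. S t (\<Omega> q \<beta> \<delta> f) \<eta>) \<longlongrightarrow> l') at_top"
    for \<eta> l l'
  proof -
    have "\<bar>l'\<bar> \<le> 0 + e" if e: "e > 0" for e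
    proof -
      obtain d where d: "d > 0"
        "\<And>h \<eta>. 0 < h \<Longrightarrow> h < d \<Longrightarrow> \<bar>S h f \<eta> - f \<eta> - h * \<Omega> q \<beta> \<delta> f \<eta>\<bar> \<le> e * h"
        using S_first_order[OF f e] by metis
      define h where "h = d / 2"
      have h: "0 < h" "h < d" using d(1) by (auto simp: h_def)
      have ch: "continuous_on UNIV (S h f)" using h cf by (intro S_continuous) auto
      have "\<bar>S (h + t) f \<eta> - S t f \<eta> - h * S t (\<Omega> q \<beta> \<delta> f) \<eta>\<bar> \<le> e * h" if "t \<ge> 0" for t
      proof -
        have "S (h + t) f \<eta> - S t f \<eta> - h * S t (\<Omega> q \<beta> \<delta> f) \<eta> = S t (\<lambda>\<eta>. S h f \<eta> - f \<eta> - h * \<Omega> q \<beta> \<delta> f \<eta>) \<eta>"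
          using that h cf cg ch S_add_time[of t h f \<eta>]
          by (simp add: S_diff S_scale continuous_on_diff continuous_on_mult_left add.commute)
        also have "\<bar>\<dots>\<bar> \<le> e * h"
          using that d(2)[OF h] cf cg ch by (intro S_abs_le continuous_intros) auto
        finally show ?thesis .
      qed
      then have ev: "\<forall>\<^sub>F t in at_top. \<bar>S (h + t) f \<eta> - S t f \<eta> - h * S t (\<Omega> q \<beta> \<delta> f) \<eta>\<bar> \<le> e * h"
        by (rule eventually_mono[OF eventually_ge_at_top[of 0]])
      have "filterlim (\<lambda>t. h + t) at_top at_top"
        by (rule filterlim_tendsto_add_at_top[OF tendsto_const filterlim_ident])
      then have "((\<lambda>t. S (h + t) f \<eta>) \<longlongrightarrow> l) at_top"
        using l by (rule filterlim_compose[rotated])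
      then have "((\<lambda>t. \<bar>S (h + t) f \<eta> - S t f \<eta> - h * S t (\<Omega> q \<beta> \<delta> f) \<eta>\<bar>) \<longlongrightarrow> \<bar>l - l - h * l'\<bar>) at_top"
        using l l' by (intro tendsto_intros)
      then have "\<bar>l - l - h * l'\<bar> \<le> e * h" using ev by (rule tendsto_upperbound) simp
      then have "h * \<bar>l'\<bar> \<le> h * e" using h by (simp add: abs_mult mult.commute)
      then show ?thesis using h by simp
    qed
    then have "\<bar>l'\<bar> \<le> 0" by (rule field_le_epsilon)
    then show ?thesis by simp
  qed
  have "lo (\<Omega> q \<beta> \<delta> f) = 0" "hi (\<Omega> q \<beta> \<delta> f) = 0"
    using * lo_hi_tendsto[OF f] lo_hi_tendsto[OF cylinder_\<Omega>[OF f]] by blast+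
  then show ?thesis by (simp add: gap_def)
qed

end

section \<open>Flux of discrepancies through the shells\<close>

text \<open>The indicator that a particle is able to jump from \<open>x\<close> to \<open>y\<close>.\<close>

definition leap :: "int ^ 'd \<Rightarrow> int ^ 'd \<Rightarrow> 'd config \<Rightarrow> real" where
  "leap x y \<eta> = of_bool (\<eta> x \<and> \<not> \<eta> y)"

lemma cylinder_leap [simp]: "cylinder_function (leap x y)"
  by (rule cylinder_functionI[of "{x, y}"]) (auto simp: leap_def)

lemma card_lattice_ball:
  assumes "n \<ge> 0"
  shows "card {y :: int ^ 'd. lattice_norm (x - y) \<le> n} \<le> nat (2 * n + 1) ^ CARD('d)"
proof -
  let ?Pi = "\<Pi>\<^sub>E i\<in>(UNIV :: 'd set). {x $ i - n .. x $ i + n}"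
  have fin: "finite ?Pi" by (intro finite_PiE) auto
  have "card {y :: int ^ 'd. lattice_norm (x - y) \<le> n} \<le> card (vec_lambda ` ?Pi :: (int ^ 'd) set)"
    using fin by (intro card_mono finite_imageI lattice_ball_subset)
  also have "\<dots> \<le> card ?Pi" by (rule card_image_le[OF fin])
  also have "\<dots> = nat (2 * n + 1) ^ CARD('d)" by (simp add: card_PiE)
  finally show ?thesis .
qed

lemma T_box_eq_ball: "T_box r = {y. lattice_norm (0 - y) \<le> \<lfloor>r\<rfloor>}"
  unfolding T_box_def lattice_norm_le_iff le_floor_iff[symmetric] by simp

lemma finite_T_box [simp]: "finite (T_box r)"
  by (simp only: T_box_eq_ball finite_lattice_ball)

lemma finite_T_shell [simp]: "finite (T_shell N r)"
  by (simp add: T_shell_def)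

lemma T_box_mono: "r \<le> s \<Longrightarrow> T_box r \<subseteq> T_box s"
  unfolding T_box_def by (auto intro: order_trans)

lemma card_T_box:
  assumes "r \<ge> 0"
  shows "real (card (T_box r :: (int ^ 'd) set)) \<le> (2 * r + 1) ^ CARD('d)"
proof -
  have 0: "\<lfloor>r\<rfloor> \<ge> 0" using assms by simp
  have "real (card (T_box r :: (int ^ 'd) set)) \<le> real (nat (2 * \<lfloor>r\<rfloor> + 1) ^ CARD('d))"
    unfolding T_box_eq_ball using card_lattice_ball[OF 0] by (intro of_nat_mono)
  also have "\<dots> = (2 * real_of_int \<lfloor>r\<rfloor> + 1) ^ CARD('d)" using 0 by simp
  also have "\<dots> \<le> (2 * r + 1) ^ CARD('d)" using 0 by (intro power_mono) (auto simp: of_int_floor_le)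
  finally show ?thesis .
qed

lemma card_T_shell_line:
  assumes "CARD('d) = 1"
  shows "card (T_shell N r :: (int ^ 'd) set) \<le> 2 * N"
proof -
  obtain i :: 'd where i: "UNIV = {i}" using assms by (auto simp: card_1_singleton_iff)
  have all: "(\<forall>j. Q j) \<longleftrightarrow> Q i" for Q :: "'d \<Rightarrow> bool" using i by (metis UNIV_I singletonD)
  let ?f = "\<lambda>x :: int ^ 'd. x $ i"
  let ?J = "{\<lfloor>r\<rfloor> + 1 .. \<lfloor>r\<rfloor> + int N}"
  have inj: "inj_on ?f (T_shell N r)" by (auto simp: inj_on_def vec_eq_iff all)
  have "?f ` T_shell N r \<subseteq> ?J \<union> uminus ` ?J"
  proof
    fix k assume "k \<in> ?f ` T_shell N r"
    then obtain x :: "int ^ 'd" where x: "k = x $ i" "x \<in> T_shell N r" by auto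
    then have "real_of_int \<bar>k\<bar> \<le> r + real N" "\<not> real_of_int \<bar>k\<bar> \<le> r"
      by (auto simp: T_shell_def T_box_def all)
    then have "\<bar>k\<bar> \<in> ?J" by (auto simp: le_floor_iff floor_less_iff) linarith+
    then show "k \<in> ?J \<union> uminus ` ?J"
      by (cases "k \<ge> 0") (auto intro!: image_eqI[of _ _ "- k"])
  qed
  then have "card (T_shell N r :: (int ^ 'd) set) \<le> card (?J \<union> uminus ` ?J)"
    using card_inj_on_le[OF inj] by blast
  also have "\<dots> \<le> card ?J + card (uminus ` ?J)" by (rule card_Un_le)
  also have "\<dots> \<le> card ?J + card ?J" by (intro add_mono card_image_le) auto
  finally show ?thesis by simp
qed

context noisy_exclusion
begin

text \<open>Under the basic coupling of the processes started from the empty and from the full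
  configuration, this is the limiting probability of a discrepancy at \<open>x\<close>.\<close>

definition disc :: "int ^ 'd \<Rightarrow> real" where
  "disc x = gap (\<lambda>\<eta>. of_bool (\<eta> x))"

lemma disc_nonneg [simp]: "disc x \<ge> 0"
  unfolding disc_def by (rule gap_nonneg) (auto simp: mono_def le_fun_def)

lemma disc_le_1: "disc x \<le> 1"
  unfolding disc_def
proof (rule tendsto_upperbound[OF gap_tendsto])
  let ?f = "\<lambda>\<eta> :: 'd config. of_bool (\<eta> x) :: real"
  have cf: "continuous_on UNIV ?f" by (rule cylinder_continuous) simp
  show "\<forall>\<^sub>F t in at_top. S t ?f top - S t ?f bot \<le> 1"
    using eventually_ge_at_top[of 0]
  proof eventually_elim
    case (elim t)
    then show ?case
      using S_bounds(1)[OF elim cf, of 1 top] S_bounds(2)[OF elim cf, of 0 bot] by simp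
  qed
qed simp_all

text \<open>The difference between the two limits of the mean current from \<open>x\<close> to \<open>y\<close>.\<close>

definition flow :: "int ^ 'd \<Rightarrow> int ^ 'd \<Rightarrow> real" where
  "flow x y = q x y * gap (leap x y)"

lemma flow_le: "flow x y \<le> q x y * disc x"
  unfolding flow_def disc_def
  by (intro mult_left_mono gap_mono cylinder_leap) (auto simp: mono_def le_fun_def leap_def)

text \<open>The exclusion rule enters through monotonicity. Fewer jumps from \<open>x\<close> to \<open>y\<close> in the larger
  configuration require that \<open>y\<close> be blocked there by an additional particle, so the deficit is
  bounded by the discrepancies at the target, as the excess in \<open>flow_le\<close> is by those at the
  source.\<close>

lemma flow_ge: "- flow x y \<le> q x y * disc y"
proof -
  have "0 \<le> gap (\<lambda>\<eta>. of_bool (\<eta> y) + leap x y \<eta>)"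
    by (intro gap_nonneg cylinder_comp2[of _ _ "(+)"] cylinder_of_bool_site cylinder_leap)
      (auto simp: mono_def le_fun_def leap_def)
  then have "- gap (leap x y) \<le> disc y" by (simp add: gap_add disc_def)
  then have "q x y * (- gap (leap x y)) \<le> q x y * disc y" by (rule mult_left_mono) simp
  then show ?thesis by (simp add: flow_def)
qed

lemma range_zero: "lattice_norm (x - y) > int N \<Longrightarrow> q x y = 0"
  using range by (auto simp: finite_range_def)

text \<open>Conservation of the mean number of particles at \<open>x\<close>, that is, the invariance of \<open>gap\<close>
  applied to the occupation of \<open>x\<close>. The part of the noise that creates particles at a constant rate
  does not distinguish the two processes and cancels.\<close>

lemma disc_balance:
  assumes B: "finite B" "x \<in> B" "\<And>y. y \<notin> B \<Longrightarrow> lattice_norm (x - y) > int N"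
  shows "(\<Sum>y\<in>B. flow y x - flow x y) = (\<beta> x + \<delta> x) * disc x"
proof -
  let ?f = "\<lambda>\<eta> :: 'd config. of_bool (\<eta> x) :: real"
  let ?g = "\<lambda>u v. q u v * (of_bool (v = x) - of_bool (u = x))"
  have \<Omega>f: "\<Omega> q \<beta> \<delta> ?f \<eta> = (\<Sum>u\<in>B. \<Sum>v\<in>B. ?g u v * leap u v \<eta>)
      + (\<beta> x - (\<beta> x + \<delta> x) * ?f \<eta>)" for \<eta>
  proof -
    have "\<Omega> q \<beta> \<delta> ?f \<eta> = (\<Sum>u\<in>B. \<Sum>v\<in>B. q u v * (?f (move u v \<eta>) - ?f \<eta>)) +
      (\<Sum>u\<in>B. \<beta> u * (?f (\<eta>(u := True)) - ?f \<eta>) + \<delta> u * (?f (\<eta>(u := False)) - ?f \<eta>))"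
    proof (rule \<Omega>_finite_form[of B "{x}"])
      fix u v assume "u \<in> {x}" "v \<notin> B"
      then show "q u v = 0 \<and> q v u = 0"
        using B(3)[of v] range_zero[of x v] range_zero[of v x] lattice_norm_minus[of x v] by simp
    qed (use B in auto)
    moreover have "q u v * (?f (move u v \<eta>) - ?f \<eta>) = ?g u v * leap u v \<eta>" for u v
      by (auto simp: move_def leap_def)
    moreover have "(\<Sum>u\<in>B. \<beta> u * (?f (\<eta>(u := True)) - ?f \<eta>) + \<delta> u * (?f (\<eta>(u := False)) - ?f \<eta>))
        = (\<Sum>u\<in>B. if u = x then \<beta> x - (\<beta> x + \<delta> x) * ?f \<eta> else 0)"
      by (rule sum.cong) auto
    ultimately show ?thesis using B(1,2) by simp
  qed
  have c1: "cylinder_function (\<lambda>\<eta>. ?g u v * leap u v \<eta>)" for u v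
    by (rule cylinder_comp) simp
  have c2: "cylinder_function (\<lambda>\<eta>. \<Sum>v\<in>B. ?g u v * leap u v \<eta>)" for u
    by (rule cylinder_sum) (rule c1)
  have c3: "cylinder_function (\<lambda>\<eta>. \<Sum>u\<in>B. \<Sum>v\<in>B. ?g u v * leap u v \<eta>)"
    by (rule cylinder_sum) (rule c2)
  have c4: "cylinder_function (\<lambda>\<eta>. \<beta> x - (\<beta> x + \<delta> x) * ?f \<eta>)"
    by (rule cylinder_comp) simp
  have const: "gap (\<lambda>_. c) = 0" for c
  proof -
    have "gap (\<lambda>_. c) \<ge> 0" "gap (\<lambda>_. - c) \<ge> 0" by (intro gap_nonneg; simp add: mono_def)+
    moreover have "gap (\<lambda>_. - c) = - gap (\<lambda>_. c)" using gap_scale[of "\<lambda>_. c" "-1"] by simp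
    ultimately show ?thesis by simp
  qed
  have "gap (\<lambda>\<eta>. \<beta> x - (\<beta> x + \<delta> x) * ?f \<eta>) = - ((\<beta> x + \<delta> x) * disc x)"
    using gap_diff[of "\<lambda>_. \<beta> x" "\<lambda>\<eta>. (\<beta> x + \<delta> x) * ?f \<eta>"] gap_scale[of ?f "\<beta> x + \<delta> x"]
      cylinder_comp[of ?f "(*) (\<beta> x + \<delta> x)"] by (simp add: const disc_def)
  moreover have "gap (\<lambda>\<eta>. \<Sum>u\<in>B. \<Sum>v\<in>B. ?g u v * leap u v \<eta>) = (\<Sum>u\<in>B. \<Sum>v\<in>B. ?g u v * gap (leap u v))"
    by (simp add: gap_sum c2 c1 gap_scale)
  moreover have "gap (\<Omega> q \<beta> \<delta> ?f) = 0" by (rule gap_\<Omega>) simp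
  ultimately have "(\<Sum>u\<in>B. \<Sum>v\<in>B. ?g u v * gap (leap u v)) = (\<beta> x + \<delta> x) * disc x"
    using gap_add[OF c3 c4] by (simp add: \<Omega>f[abs_def])
  also have "(\<Sum>u\<in>B. \<Sum>v\<in>B. ?g u v * gap (leap u v)) =
      (\<Sum>u\<in>B. \<Sum>v\<in>B. (if v = x then flow u x else 0) - (if u = x then flow x v else 0))"
    by (intro sum.cong refl) (auto simp: flow_def)
  also have "\<dots> = (\<Sum>u\<in>B. \<Sum>v\<in>B. if v = x then flow u x else 0) - (\<Sum>u\<in>B. \<Sum>v\<in>B. if u = x then flow x v else 0)"
    by (simp add: sum_subtractf)
  also have "(\<Sum>u\<in>B. \<Sum>v\<in>B. if u = x then flow x v else 0) = (\<Sum>v\<in>B. flow x v)"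
    using B(1,2) by (subst sum.swap) simp
  also have "(\<Sum>u\<in>B. \<Sum>v\<in>B. if v = x then flow u x else 0) = (\<Sum>u\<in>B. flow u x)"
    using B(1,2) by simp
  finally show ?thesis by (simp add: sum_subtractf)
qed

text \<open>The assumptions bound the total rate of jumps out of a site. Finite range also bounds the
  total rate of jumps into it, since they come from boundedly many sites.\<close>

lemma total_rate_bound:
  obtains K where "K > 0" "\<And>y T. finite T \<Longrightarrow> (\<Sum>x\<in>T. q y x + q x y) \<le> K"
proof -
  define Q where "Q = (SUP x. \<Sum>\<^sub>\<infinity>y. q x y)"
  have out: "(\<Sum>x\<in>T. q y x) \<le> Q" if "finite T" for y T
  proof -
    have "(\<Sum>x\<in>T. q y x) \<le> (\<Sum>\<^sub>\<infinity>x. q y x)"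
      using rates that by (intro finite_sum_le_infsum) (auto simp: noisy_exclusion_rates_def)
    also have "\<dots> \<le> Q"
      unfolding Q_def using rates by (intro cSUP_upper) (auto simp: noisy_exclusion_rates_def)
    finally show ?thesis .
  qed
  have Q0: "Q \<ge> 0" using out[of "{}"] by simp
  have Q: "q x y \<le> Q" for x y using out[of "{y}" x] by simp
  let ?n = "real (nat (2 * int N + 1) ^ CARD('d))"
  have into: "(\<Sum>x\<in>T. q x y) \<le> ?n * Q" if T: "finite T" for y T
  proof -
    let ?V = "{x. lattice_norm (y - x) \<le> int N}"
    have "(\<Sum>x\<in>T. q x y) = (\<Sum>x\<in>T \<inter> ?V. q x y)"
      using T by (intro sum.mono_neutral_right) (auto intro!: range_zero simp: not_le lattice_norm_minus[of y])
    also have "\<dots> \<le> (\<Sum>x\<in>?V. q x y)"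
      by (intro sum_mono2 finite_lattice_ball) auto
    also have "\<dots> \<le> real (card ?V) * Q" by (rule sum_bounded_above) (rule Q)
    also have "\<dots> \<le> ?n * Q"
      using card_lattice_ball[of "int N" y] Q0 by (intro mult_right_mono of_nat_mono) auto
    finally show ?thesis .
  qed
  show ?thesis
  proof (rule that[of "Q + ?n * Q + 1"])
    show "0 < Q + ?n * Q + 1" using Q0 by (simp add: add_nonneg_pos)
    show "(\<Sum>x\<in>T. q y x + q x y) \<le> Q + ?n * Q + 1" if "finite T" for y T
      using out[OF that, of y] into[OF that, of y] by (simp add: sum.distrib)
  qed
qed

text \<open>The noise inside a box removes discrepancies at the rate on the left. In equilibrium they
  must be replaced through the boundary, where the exclusion rule can let discrepancies cross into
  the box only from the surrounding shell. Exchanges inside the box cancel.\<close>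

lemma flux_inequality:
  obtains K where "K > 0"
    "\<And>r. (\<Sum>x\<in>T_box r. (\<beta> x + \<delta> x) * disc x) \<le> K * (\<Sum>x\<in>T_shell N r. disc x)"
proof -
  obtain K where K: "K > 0" "\<And>y T. finite T \<Longrightarrow> (\<Sum>x\<in>T. q y x + q x y) \<le> K"
    using total_rate_bound by metis
  show ?thesis
  proof (rule that[OF K(1)])
    fix r
    let ?T = "T_box r :: (int ^ 'd) set" and ?B = "T_box (r + real N) :: (int ^ 'd) set"
    have TB: "?T \<subseteq> ?B" by (rule T_box_mono) simp
    have bal: "(\<Sum>y\<in>?B. flow y x - flow x y) = (\<beta> x + \<delta> x) * disc x" if x: "x \<in> ?T" for x
    proof (rule disc_balance)
      fix y assume y: "y \<notin> ?B"
      show "lattice_norm (x - y) > int N"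
      proof (rule ccontr)
        assume "\<not> lattice_norm (x - y) > int N"
        then have le: "\<bar>x $ i - y $ i\<bar> \<le> int N" for i
          using lattice_norm_le_iff[of "x - y" "int N"] by simp
        have "real_of_int \<bar>y $ i\<bar> \<le> r + real N" for i
        proof -
          have "\<bar>y $ i\<bar> \<le> \<bar>x $ i\<bar> + int N" using le[of i] by linarith
          then have "real_of_int \<bar>y $ i\<bar> \<le> real_of_int (\<bar>x $ i\<bar> + int N)" by (rule of_int_le_iff[THEN iffD2])
          moreover have "real_of_int \<bar>x $ i\<bar> \<le> r" using x unfolding T_box_def by blast
          ultimately show ?thesis by simp
        qed
        then show False using y by (auto simp: T_box_def)
      qed
    qed (use x TB in auto)
    have "(\<Sum>x\<in>?T. \<Sum>y\<in>?T. flow y x - flow x y) = (\<Sum>x\<in>?T. \<Sum>y\<in>?T. flow y x) - (\<Sum>x\<in>?T. \<Sum>y\<in>?T. flow x y)"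
      by (simp add: sum_subtractf)
    then have inner: "(\<Sum>x\<in>?T. \<Sum>y\<in>?T. flow y x - flow x y) = 0"
      using sum.swap[of "\<lambda>x y. flow y x" ?T ?T] by simp
    have "(\<Sum>x\<in>?T. (\<beta> x + \<delta> x) * disc x) = (\<Sum>x\<in>?T. \<Sum>y\<in>?B. flow y x - flow x y)"
      by (intro sum.cong refl) (simp only: bal)
    also have "\<dots> = (\<Sum>x\<in>?T. (\<Sum>y\<in>?B - ?T. flow y x - flow x y) + (\<Sum>y\<in>?T. flow y x - flow x y))"
      using TB by (intro sum.cong refl sum.subset_diff) auto
    also have "\<dots> = (\<Sum>x\<in>?T. \<Sum>y\<in>T_shell N r. flow y x - flow x y)"
      using inner by (simp add: sum.distrib T_shell_def)
    also have "\<dots> \<le> (\<Sum>x\<in>?T. \<Sum>y\<in>T_shell N r. (q y x + q x y) * disc y)"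
    proof (intro sum_mono)
      fix x y
      show "flow y x - flow x y \<le> (q y x + q x y) * disc y"
        using flow_le[of y x] flow_ge[of x y] by (simp add: distrib_right)
    qed
    also have "\<dots> = (\<Sum>y\<in>T_shell N r. (\<Sum>x\<in>?T. q y x + q x y) * disc y)"
      by (subst sum.swap) (simp only: sum_distrib_right)
    also have "\<dots> \<le> (\<Sum>y\<in>T_shell N r. K * disc y)"
      by (intro sum_mono mult_right_mono K(2)) auto
    finally show "(\<Sum>x\<in>?T. (\<beta> x + \<delta> x) * disc x) \<le> K * (\<Sum>x\<in>T_shell N r. disc x)"
      by (simp only: sum_distrib_left)
  qed
qed

end

section \<open>Growth of the flux along the shells\<close>

text \<open>Once the accumulated sum has reached a value \<open>s > 0\<close>, every later \<open>A l\<close> is at least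
  \<open>s / K\<close>, so the sum grows at least like \<open>s / K\<close> times the divergent sum of the weights. But it is at
  most \<open>K * C\<close>.\<close>

lemma divergent_weights_exclude_bounded:
  fixes A b :: "nat \<Rightarrow> real"
  assumes b: "\<And>l. l \<ge> 1 \<Longrightarrow> b l \<ge> 0" and A: "\<And>l. l \<ge> 1 \<Longrightarrow> A l > 0" and K: "K > 0"
    and le: "\<And>l. l \<ge> 1 \<Longrightarrow> (\<Sum>j=1..<l. b j * A j) \<le> K * A l"
    and bounded: "\<And>l. l \<ge> 1 \<Longrightarrow> A l \<le> C"
    and diverges: "filterlim (\<lambda>n. \<Sum>l=1..n. b l) at_top sequentially"
  shows False
proof -
  define T where "T = (\<lambda>l. \<Sum>j=1..<l. b j * A j)"
  have "\<forall>\<^sub>F n in sequentially. 1 \<le> (\<Sum>l=1..n. b l)"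
    using diverges by (simp add: filterlim_at_top)
  then obtain n where "1 \<le> (\<Sum>l=1..n. b l)" by (auto simp: eventually_sequentially)
  then have "\<exists>m\<in>{1..n}. b m > 0"
    using sum_nonpos[of "{1..n}" b] by (force simp: not_less)
  then obtain m where m: "m \<ge> 1" "b m > 0" by auto
  have pos: "b j * A j \<ge> 0" if "j \<ge> 1" for j using b[OF that] A[OF that] by simp
  have mono: "T l \<le> T l'" if "l \<le> l'" for l l'
    unfolding T_def using that by (intro sum_mono2) (auto intro: pos)
  define s where "s = T (Suc m)"
  have "T (Suc m) = T m + b m * A m" using m(1) by (simp add: T_def)
  moreover have "T m \<ge> 0" unfolding T_def by (intro sum_nonneg pos) auto
  ultimately have s: "s > 0" using m A[OF m(1)] by (simp add: s_def add_nonneg_pos)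
  have low: "s / K \<le> A l" if "l > m" for l
  proof -
    have "s \<le> T l" unfolding s_def using that by (intro mono) simp
    also have "\<dots> \<le> K * A l" unfolding T_def using that by (intro le) simp
    finally show ?thesis using K by (simp add: field_simps)
  qed
  have bound: "(\<Sum>l=1..n. b l) \<le> (\<Sum>l=1..m. b l) + K * (K * C) / s" for n
  proof -
    have "s / K * (\<Sum>l\<in>{m<..n}. b l) = (\<Sum>l\<in>{m<..n}. b l * (s / K))"
      by (simp add: sum_distrib_left mult.commute)
    also have "\<dots> \<le> (\<Sum>l\<in>{m<..n}. b l * A l)"
      using low b by (intro sum_mono mult_left_mono) auto
    also have "\<dots> \<le> T (Suc n)"
      unfolding T_def by (intro sum_mono2) (auto intro: pos)
    also have "\<dots> \<le> K * A (Suc n)" unfolding T_def by (intro le) simp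
    also have "\<dots> \<le> K * C" using K bounded by simp
    finally have 1: "(\<Sum>l\<in>{m<..n}. b l) \<le> K * (K * C) / s"
      using s K by (simp add: field_simps)
    have "(\<Sum>l=1..n. b l) \<le> (\<Sum>l\<in>{1..m} \<union> {m<..n}. b l)"
      using m(1) by (intro sum_mono2) (auto intro: b)
    also have "\<dots> = (\<Sum>l=1..m. b l) + (\<Sum>l\<in>{m<..n}. b l)"
      by (intro sum.union_disjoint) auto
    finally show ?thesis using 1 by simp
  qed
  have "\<forall>\<^sub>F n in sequentially. (\<Sum>l=1..m. b l) + K * (K * C) / s + 1 \<le> (\<Sum>l=1..n. b l)"
    using diverges by (simp add: filterlim_at_top)
  then obtain n where "(\<Sum>l=1..m. b l) + K * (K * C) / s + 1 \<le> (\<Sum>l=1..n. b l)"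
    by (auto simp: eventually_sequentially)
  then show False using bound[of n] by simp
qed

lemma one_plus_power_le:
  fixes x :: real
  assumes "0 \<le> x" "x \<le> 1"
  shows "(1 + x) ^ c \<le> 1 + (2 ^ c - 1) * x"
proof (induction c)
  case (Suc c)
  have "(2 ^ c - 1) * (x * x) \<le> (2 ^ c - 1) * x"
    using assms by (intro mult_left_mono) (auto simp: mult_left_le)
  moreover have "(1 + x) ^ Suc c \<le> (1 + (2 ^ c - 1) * x) * (1 + x)"
    using Suc.IH assms by (simp add: mult.commute[of "1 + x"] mult_right_mono)
  moreover have "(1 + (2 ^ c - 1) * x) * (1 + x) = 1 + 2 ^ c * x + (2 ^ c - 1) * (x * x)"
    by (simp add: algebra_simps)
  moreover have "(2 ^ Suc c - 1) * x = 2 ^ c * x + (2 ^ c - 1) * x" by (simp add: algebra_simps)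
  ultimately show ?case by linarith
qed simp

text \<open>Each shell increases the accumulated sum by a factor at least \<open>1 + b l / K\<close>. As soon as
  \<open>b l \<ge> 2 ^ c K / l\<close>, such factors multiply to at least the order of \<open>l ^ c\<close>, for any \<open>c\<close>.\<close>

lemma slow_weights_exclude_polynomial:
  fixes A b :: "nat \<Rightarrow> real"
  assumes b: "\<And>l. l \<ge> 1 \<Longrightarrow> b l \<ge> 0" and A: "\<And>l. l \<ge> 1 \<Longrightarrow> A l > 0" and K: "K > 0"
    and le: "\<And>l. l \<ge> 1 \<Longrightarrow> (\<Sum>j=1..<l. b j * A j) \<le> K * A l"
    and polynomial: "\<And>l. l \<ge> 1 \<Longrightarrow> A l \<le> C * real l ^ M"
    and slow: "filterlim (\<lambda>l. real l * b l) at_top sequentially"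
  shows False
proof -
  define T where "T = (\<lambda>l. \<Sum>j=1..<l. b j * A j)"
  \<comment> \<open>One power more than \<open>A\<close> can have.\<close>
  define c where "c = Suc M"
  have "\<forall>\<^sub>F l in sequentially. K * 2 ^ c \<le> real l * b l"
    using slow by (simp add: filterlim_at_top)
  then obtain m0 where m0: "\<And>l. l \<ge> m0 \<Longrightarrow> K * 2 ^ c \<le> real l * b l"
    by (auto simp: eventually_sequentially)
  define m where "m = max 1 m0"
  have m: "m \<ge> 1" and bm: "\<And>l. l \<ge> m \<Longrightarrow> K * 2 ^ c \<le> real l * b l"
    using m0 by (auto simp: m_def)
  have T_Suc: "T (Suc l) = T l + b l * A l" if "l \<ge> 1" for l using that by (simp add: T_def)
  have T0: "T l \<ge> 0" for l
    unfolding T_def using b A by (intro sum_nonneg) (simp add: less_imp_le)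
  have "0 < K * 2 ^ c" using K by simp
  also have "\<dots> \<le> real m * b m" by (rule bm) simp
  finally have "b m > 0" using m by (simp add: zero_less_mult_iff)
  then have "T (Suc m) > 0" using T_Suc[OF m] T0[of m] A[OF m] by (simp add: add_nonneg_pos)
  define s where "s = T (Suc m) / real (Suc m) ^ c"
  have s: "s > 0" unfolding s_def using \<open>T (Suc m) > 0\<close> by (intro divide_pos_pos) auto
  have growth: "s * real l ^ c \<le> T l" if "l \<ge> Suc m" for l
    using that
  proof (induction l rule: dec_induct)
    case base
    then show ?case by (simp add: s_def del: of_nat_Suc)
  next
    case (step l)
    have l: "l \<ge> 1" "l \<ge> m" using step.hyps m by auto
    have bl: "2 ^ c / real l \<le> b l / K" using bm[OF l(2)] l K by (simp add: field_simps)
    have "real (Suc l) ^ c = real l ^ c * (1 + 1 / real l) ^ c"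
      using l by (simp add: field_simps flip: power_mult_distrib)
    also have "(1 + 1 / real l) ^ c \<le> 1 + (2 ^ c - 1) * (1 / real l)"
      using l by (intro one_plus_power_le) auto
    also have "\<dots> \<le> 1 + 2 ^ c / real l" using l by (simp add: field_simps)
    also have "\<dots> \<le> 1 + b l / K" using bl by simp
    finally have "real (Suc l) ^ c \<le> real l ^ c * (1 + b l / K)" by (simp add: mult_left_mono)
    then have "s * real (Suc l) ^ c \<le> s * (real l ^ c * (1 + b l / K))" using s by simp
    also have "\<dots> = (s * real l ^ c) * (1 + b l / K)" by simp
    also have "\<dots> \<le> T l * (1 + b l / K)"
      using step.IH b[OF l(1)] K by (intro mult_right_mono) auto
    also have "\<dots> = T l + b l * (T l / K)" by (simp add: algebra_simps)
    also have "\<dots> \<le> T l + b l * A l"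
      using le[OF l(1)] b[OF l(1)] K
      by (intro add_left_mono mult_left_mono) (simp_all add: T_def field_simps)
    finally show ?case by (simp only: T_Suc[OF l(1)])
  qed
  obtain n :: nat where n: "K * C / s < n" using reals_Archimedean2 by blast
  define l where "l = max n (Suc m)"
  have l: "l \<ge> 1" "l \<ge> Suc m" "K * C / s < l" using n by (auto simp: l_def)
  have "s * real l ^ c \<le> K * A l" using growth[OF l(2)] le[OF l(1)] by (simp add: T_def)
  also have "\<dots> \<le> K * (C * real l ^ M)" using polynomial[OF l(1)] K by simp
  finally have "(s * real l) * real l ^ M \<le> (K * C) * real l ^ M" by (simp add: c_def algebra_simps)
  then have "s * real l \<le> K * C" using l(1) by simp
  moreover have "K * C < s * real l" using l(3) s by (simp add: field_simps)
  ultimately show False by simp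
qed

section \<open>Irreducibility spreads the absence of discrepancies\<close>

context noisy_exclusion
begin

text \<open>A property of ordered pairs is negligible if a monotone function with vanishing gap
  strictly separates all pairs having it. In terms of a monotone coupling of the two limiting laws,
  such a property has probability zero; the definition avoids having to construct the coupling.
  The separation by \<open>1\<close> rather than by any positive amount makes domination uniform.\<close>

definition negligible :: "('d config \<Rightarrow> 'd config \<Rightarrow> bool) \<Rightarrow> bool" where
  "negligible E \<longleftrightarrow> (\<exists>F. cylinder_function F \<and> mono F \<and> gap F = 0 \<and>
     (\<forall>\<eta> \<zeta>. \<eta> \<le> \<zeta> \<longrightarrow> E \<eta> \<zeta> \<longrightarrow> F \<eta> + 1 \<le> F \<zeta>))"

lemma negligible_disc_iff: "negligible (\<lambda>\<eta> \<zeta>. \<not> \<eta> x \<and> \<zeta> x) \<longleftrightarrow> disc x = 0"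
proof
  assume "negligible (\<lambda>\<eta> \<zeta>. \<not> \<eta> x \<and> \<zeta> x)"
  then obtain F where F: "cylinder_function F" "mono F" "gap F = 0"
    "\<forall>\<eta> \<zeta>. \<eta> \<le> \<zeta> \<longrightarrow> \<not> \<eta> x \<and> \<zeta> x \<longrightarrow> F \<eta> + 1 \<le> F \<zeta>"
    unfolding negligible_def by (elim exE conjE)
  have "mono (\<lambda>\<eta>. F \<eta> - of_bool (\<eta> x))"
  proof (rule monoI)
    fix \<eta> \<zeta> :: "'d config" assume le: "\<eta> \<le> \<zeta>"
    have "F \<eta> \<le> F \<zeta>" using F(2) le by (rule monoD)
    moreover have "\<not> \<eta> x \<Longrightarrow> \<zeta> x \<Longrightarrow> F \<eta> + 1 \<le> F \<zeta>" using F(4) le by simp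
    moreover have "\<eta> x \<Longrightarrow> \<zeta> x" using le by (auto simp: le_fun_def)
    ultimately show "F \<eta> - of_bool (\<eta> x) \<le> F \<zeta> - of_bool (\<zeta> x)"
      by (cases "\<eta> x"; cases "\<zeta> x") auto
  qed
  then have "disc x \<le> gap F" unfolding disc_def by (intro gap_mono F(1)) simp_all
  then show "disc x = 0" using F(3) disc_nonneg[of x] by simp
next
  assume "disc x = 0"
  then show "negligible (\<lambda>\<eta> \<zeta>. \<not> \<eta> x \<and> \<zeta> x)"
    unfolding negligible_def disc_def
    by (intro exI[of _ "\<lambda>\<eta>. of_bool (\<eta> x)"]) (auto simp: mono_def le_fun_def)
qed

lemma negligible_subset:
  assumes "negligible E" "\<And>\<eta> \<zeta>. \<eta> \<le> \<zeta> \<Longrightarrow> E' \<eta> \<zeta> \<Longrightarrow> E \<eta> \<zeta>"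
  shows "negligible E'"
proof -
  obtain F where F: "cylinder_function F" "mono F" "gap F = 0"
    "\<forall>\<eta> \<zeta>. \<eta> \<le> \<zeta> \<longrightarrow> E \<eta> \<zeta> \<longrightarrow> F \<eta> + 1 \<le> F \<zeta>"
    using assms(1) unfolding negligible_def by (elim exE conjE)
  show ?thesis
    unfolding negligible_def
    by (intro exI[of _ F] conjI F(1-3) allI impI F(4)[rule_format] assms(2))
qed

lemma negligible_disj:
  assumes "negligible E" "negligible E'"
  shows "negligible (\<lambda>\<eta> \<zeta>. E \<eta> \<zeta> \<or> E' \<eta> \<zeta>)"
proof -
  obtain F where F: "cylinder_function F" "mono F" "gap F = 0"
    "\<forall>\<eta> \<zeta>. \<eta> \<le> \<zeta> \<longrightarrow> E \<eta> \<zeta> \<longrightarrow> F \<eta> + 1 \<le> F \<zeta>"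
    using assms(1) unfolding negligible_def by (elim exE conjE)
  obtain F' where F': "cylinder_function F'" "mono F'" "gap F' = 0"
    "\<forall>\<eta> \<zeta>. \<eta> \<le> \<zeta> \<longrightarrow> E' \<eta> \<zeta> \<longrightarrow> F' \<eta> + 1 \<le> F' \<zeta>"
    using assms(2) unfolding negligible_def by (elim exE conjE)
  show ?thesis
    unfolding negligible_def
  proof (intro exI[of _ "\<lambda>\<eta>. F \<eta> + F' \<eta>"] conjI allI impI)
    show "cylinder_function (\<lambda>\<eta>. F \<eta> + F' \<eta>)" by (rule cylinder_comp2[OF F(1) F'(1)])
    show "mono (\<lambda>\<eta>. F \<eta> + F' \<eta>)" using F(2) F'(2) by (auto simp: mono_def intro: add_mono)
    show "gap (\<lambda>\<eta>. F \<eta> + F' \<eta>) = 0" by (simp add: gap_add F F')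
    fix \<eta> \<zeta> assume le: "\<eta> \<le> \<zeta>" and E: "E \<eta> \<zeta> \<or> E' \<eta> \<zeta>"
    show "F \<eta> + F' \<eta> + 1 \<le> F \<zeta> + F' \<zeta>"
      using E F(4)[rule_format, OF le] F'(4)[rule_format, OF le] monoD[OF F(2) le] monoD[OF F'(2) le]
      by (elim disjE) (drule (1) meta_mp | linarith)+
  qed
qed

lemma negligible_False: "negligible (\<lambda>\<eta> \<zeta>. False)"
  unfolding negligible_def using gap_scale[of "\<lambda>_. 0" 0]
  by (intro exI[of _ "\<lambda>_. 0"]) (auto simp: mono_def)

lemma negligible_bex:
  assumes "\<And>k :: nat. k < m \<Longrightarrow> negligible (E k)"
  shows "negligible (\<lambda>\<eta> \<zeta>. \<exists>k<m. E k \<eta> \<zeta>)"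
  using assms
proof (induction m)
  case 0
  then show ?case by (simp add: negligible_False)
next
  case (Suc m)
  have "negligible (\<lambda>\<eta> \<zeta>. (\<exists>k<m. E k \<eta> \<zeta>) \<or> E m \<eta> \<zeta>)"
    by (intro negligible_disj Suc) simp_all
  then show ?case by (rule negligible_subset) (auto simp: less_Suc_eq)
qed

text \<open>The invariance of the gap writes \<open>0\<close> as a sum of terms \<open>rate * gap (F \<circ> transition)\<close>, all of
  them nonnegative by attractiveness. Hence every term with a positive rate vanishes.\<close>

lemma gap_move_eq_0:
  assumes F: "cylinder_function F" "mono F" "gap F = 0" and q: "q u v > 0"
  shows "gap (\<lambda>\<eta>. F (move u v \<eta>)) = 0"
proof -
  have fin: "finite {u, v}" by simp
  obtain B where B: "finite B" "{u, v} \<subseteq> B"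
    "\<forall>\<eta>. \<Omega> q \<beta> \<delta> F \<eta> = (\<Sum>x\<in>B. \<Sum>y\<in>B. q x y * (F (move x y \<eta>) - F \<eta>)) +
    (\<Sum>x\<in>B. \<beta> x * (F (\<eta>(x := True)) - F \<eta>) + \<delta> x * (F (\<eta>(x := False)) - F \<eta>))"
    using \<Omega>_cylinder[OF F(1) fin] by (elim exE conjE)
  have trm: "cylinder_function (\<lambda>\<eta>. r * (G \<eta> - F \<eta>))" "gap (\<lambda>\<eta>. r * (G \<eta> - F \<eta>)) = r * gap G"
    if "cylinder_function G" for r G
    using cylinder_comp2[OF that F(1), of "\<lambda>a b. r * (a - b)"] gap_scale[OF cylinder_comp2[OF that F(1), of "(-)"], of r]
      gap_diff[OF that F(1)] F(3) by simp_all
  note m = trm[OF cylinder_move[OF F(1)]] and up = trm[OF cylinder_upd[OF F(1)]]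
  have moves: "0 \<le> gap (\<lambda>\<eta>. F (move x y \<eta>))" for x y
    using F(2) by (intro gap_nonneg cylinder_move F(1)) (auto simp: mono_def move_mono)
  have upds: "0 \<le> gap (\<lambda>\<eta>. F (\<eta>(x := b)))" for x b
    using F(2) by (intro gap_nonneg cylinder_upd F(1)) (auto simp: mono_def upd_mono)
  let ?X = "\<lambda>x \<eta>. \<Sum>y\<in>B. q x y * (F (move x y \<eta>) - F \<eta>)"
  let ?Y = "\<lambda>x \<eta>. \<beta> x * (F (\<eta>(x := True)) - F \<eta>) + \<delta> x * (F (\<eta>(x := False)) - F \<eta>)"
  have cX: "cylinder_function (?X x)" for x by (intro cylinder_sum m)
  have cY: "cylinder_function (?Y x)" for x
    by (rule cylinder_comp2[of _ _ "(+)"]) (rule up)+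
  have gX: "gap (?X x) = (\<Sum>y\<in>B. q x y * gap (\<lambda>\<eta>. F (move x y \<eta>)))" for x
    by (subst gap_sum) (rule m sum.cong refl)+
  have gY: "gap (?Y x) = \<beta> x * gap (\<lambda>\<eta>. F (\<eta>(x := True))) + \<delta> x * gap (\<lambda>\<eta>. F (\<eta>(x := False)))" for x
    by (subst gap_add) (simp_all only: up)
  have "0 = gap (\<Omega> q \<beta> \<delta> F)" by (rule gap_\<Omega>[OF F(1), symmetric])
  also have "\<Omega> q \<beta> \<delta> F = (\<lambda>\<eta>. (\<Sum>x\<in>B. ?X x \<eta>) + (\<Sum>x\<in>B. ?Y x \<eta>))"
    by (intro ext) (rule B(3)[rule_format])
  also have "gap \<dots> = (\<Sum>x\<in>B. gap (?X x)) + (\<Sum>x\<in>B. gap (?Y x))"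
    by (subst gap_add[OF cylinder_sum[OF cX] cylinder_sum[OF cY]]) (simp only: gap_sum[OF cX] gap_sum[OF cY])
  finally have sum0: "(\<Sum>x\<in>B. gap (?X x)) + (\<Sum>x\<in>B. gap (?Y x)) = 0" by simp
  have "0 \<le> (\<Sum>x\<in>B. gap (?Y x))"
    unfolding gY by (intro sum_nonneg add_nonneg_nonneg mult_nonneg_nonneg upds) auto
  moreover have nX: "0 \<le> gap (?X x)" for x
    unfolding gX by (intro sum_nonneg mult_nonneg_nonneg moves) auto
  ultimately have "(\<Sum>x\<in>B. gap (?X x)) = 0"
    using sum0 sum_nonneg[of B "\<lambda>x. gap (?X x)"] by (smt (verit))
  then have "gap (?X u) = 0"
    using sum_nonneg_eq_0_iff[OF B(1), of "\<lambda>x. gap (?X x)"] nX B(2) by simp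
  then have "(\<Sum>y\<in>B. q u y * gap (\<lambda>\<eta>. F (move u y \<eta>))) = 0" by (simp only: gX)
  then have "q u v * gap (\<lambda>\<eta>. F (move u v \<eta>)) = 0"
    using sum_nonneg_eq_0_iff[OF B(1), of "\<lambda>y. q u y * gap (\<lambda>\<eta>. F (move u y \<eta>))"] moves B(2) by simp
  then show ?thesis using q by simp
qed

lemma negligible_move:
  assumes "negligible E" "q u v > 0"
  shows "negligible (\<lambda>\<eta> \<zeta>. E (move u v \<eta>) (move u v \<zeta>))"
proof -
  obtain F where F: "cylinder_function F" "mono F" "gap F = 0"
    "\<forall>\<eta> \<zeta>. \<eta> \<le> \<zeta> \<longrightarrow> E \<eta> \<zeta> \<longrightarrow> F \<eta> + 1 \<le> F \<zeta>"
    using assms(1) unfolding negligible_def by (elim exE conjE)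
  show ?thesis
    unfolding negligible_def
  proof (intro exI[of _ "\<lambda>\<eta>. F (move u v \<eta>)"] conjI allI impI)
    show "mono (\<lambda>\<eta>. F (move u v \<eta>))" using F(2) by (auto simp: mono_def move_mono)
    fix \<eta> \<zeta> assume "\<eta> \<le> \<zeta>" "E (move u v \<eta>) (move u v \<zeta>)"
    then show "F (move u v \<eta>) + 1 \<le> F (move u v \<zeta>)" by (intro F(4)[rule_format] move_mono)
  qed (intro cylinder_move gap_move_eq_0 F assms(2))+
qed

text \<open>A discrepancy at a site \<open>y\<close> from which particles jump to \<open>x\<close> can be brought to \<open>x\<close>. Follow a path of possible jumps from
  \<open>x\<close> to \<open>y\<close>. If it meets a site that is empty in both configurations before \<open>y\<close>, that hole can be
  pulled back to \<open>x\<close>, and then the discrepancy jumps from \<open>y\<close> to \<open>x\<close>. Otherwise all sites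
  before the first discrepancy on the path are occupied in both configurations, and those particles,
  jumping forwards one after the other, pull this discrepancy back to \<open>x\<close>.\<close>

lemma disc_zero_step:
  assumes path: "(\<lambda>u v. q u v > 0)\<^sup>*\<^sup>* x y" and q: "q y x > 0" and x: "disc x = 0"
  shows "disc y = 0"
proof -
  obtain n where "((\<lambda>u v. q u v > 0) ^^ n) x y" using path by (auto dest: rtranclp_imp_relpowp)
  then obtain z where z: "z 0 = x" "z n = y" "\<And>i. i < n \<Longrightarrow> q (z i) (z (Suc i)) > 0"
    by (auto simp: relpowp_fun_conv)
  \<comment> \<open>Stop at the first visit to \<open>y\<close>, so that moving a hole along the path leaves \<open>y\<close> alone.\<close>
  define m where "m = (LEAST i. z i = y)"
  have m: "z m = y" "m \<le> n" unfolding m_def using z(2) by (auto intro: LeastI Least_le)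
  have before: "z i \<noteq> y" if "i < m" for i using that not_less_Least unfolding m_def by blast
  have jump: "q (z i) (z (Suc i)) > 0" if "i < m" for i using z(3) m(2) that by simp
  have disc_x: "negligible (\<lambda>\<eta> \<zeta>. \<not> \<eta> x \<and> \<zeta> x)" using x by (simp only: negligible_disc_iff)
  \<comment> \<open>No hole among the first sites of the path, but a discrepancy.\<close>
  define E where "E = (\<lambda>k \<eta> \<zeta>. (\<exists>j\<le>k. \<not> \<eta> (z j) \<and> \<zeta> (z j)) \<and> (\<forall>i\<le>k. \<zeta> (z i)))"
  have E: "negligible (E k)" if "k \<le> m" for k
    using that
  proof (induction k)
    case 0
    show ?case by (rule negligible_subset[OF disc_x]) (simp add: E_def z(1))
  next
    case (Suc k)
    then have IH: "negligible (E k)" and qk: "q (z k) (z (Suc k)) > 0" by (simp_all add: jump)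
    show ?case
    proof (rule negligible_subset[OF negligible_disj[OF IH negligible_move[OF IH qk]]])
      fix \<eta> \<zeta> assume le: "\<eta> \<le> \<zeta>" and e: "E (Suc k) \<eta> \<zeta>"
      show "E k \<eta> \<zeta> \<or> E k (move (z k) (z (Suc k)) \<eta>) (move (z k) (z (Suc k)) \<zeta>)"
      proof (cases "\<exists>j\<le>k. \<not> \<eta> (z j) \<and> \<zeta> (z j)")
        case True
        then show ?thesis using e by (auto simp: E_def)
      next
        case False
        then have "\<not> \<eta> (z (Suc k))" "\<eta> (z k)" using e by (auto simp: E_def le_Suc_eq)
        moreover have "\<zeta> (z i)" if "i \<le> Suc k" for i using e that by (simp add: E_def)
        ultimately have "E k (move (z k) (z (Suc k)) \<eta>) (move (z k) (z (Suc k)) \<zeta>)"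
          unfolding E_def by (intro conjI exI[of _ k]) (auto simp: move_def)
        then show ?thesis ..
      qed
    qed
  qed
  \<comment> \<open>A discrepancy at \<open>y\<close> and a hole at the \<open>k\<close>-th site of the path.\<close>
  define G where "G = (\<lambda>k \<eta> \<zeta>. \<not> \<eta> y \<and> \<zeta> y \<and> \<not> \<zeta> (z k))"
  have G: "negligible (G k)" if "k < m" for k
    using that
  proof (induction k)
    case 0
    show ?case
      by (rule negligible_subset[OF negligible_move[OF disc_x q]])
        (auto simp: G_def z(1) move_def le_fun_def)
  next
    case (Suc k)
    then have IH: "negligible (G k)" and qk: "q (z k) (z (Suc k)) > 0" by (simp_all add: jump)
    have "y \<noteq> z k" "y \<noteq> z (Suc k)" using before[of k] before[of "Suc k"] Suc.prems by auto
    then show ?case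
      by (intro negligible_subset[OF negligible_move[OF IH qk]]) (auto simp: G_def move_def)
  qed
  have "negligible (\<lambda>\<eta> \<zeta>. (\<exists>k<m. G k \<eta> \<zeta>) \<or> E m \<eta> \<zeta>)"
    by (intro negligible_disj negligible_bex G E) auto
  then have "negligible (\<lambda>\<eta> \<zeta>. \<not> \<eta> y \<and> \<zeta> y)"
  proof (rule negligible_subset)
    fix \<eta> \<zeta> assume d: "\<not> \<eta> y \<and> \<zeta> y"
    show "(\<exists>k<m. G k \<eta> \<zeta>) \<or> E m \<eta> \<zeta>"
    proof (cases "\<exists>k<m. \<not> \<zeta> (z k)")
      case True
      then show ?thesis using d by (auto simp: G_def)
    next
      case False
      then have "\<forall>i\<le>m. \<zeta> (z i)" using d m(1) by (auto simp: le_less)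
      then show ?thesis using d m(1) by (auto simp: E_def)
    qed
  qed
  then show ?thesis by (simp only: negligible_disc_iff)
qed

text \<open>Along a path of possible jumps from \<open>y\<close> to \<open>x\<close> the previous lemma is applied backwards. It
  also uses a path in the other direction for each step.\<close>

lemma disc_zero_everywhere:
  assumes irr: "irreducible_rates q" and x: "disc x = 0"
  shows "disc y = 0"
proof -
  have "(\<lambda>u v. q u v > 0)\<^sup>*\<^sup>* y x" using irr by (simp add: irreducible_rates_def)
  then show ?thesis
  proof (induction rule: converse_rtranclp_induct)
    case base
    show ?case by (rule x)
  next
    case (step y z)
    then show ?case using irr by (intro disc_zero_step[of z y]) (auto simp: irreducible_rates_def)
  qed
qed

end

section \<open>Ergodicity\<close>

lemma weak_convergence_from_cylinders:
  fixes m :: "real \<Rightarrow> 'd::finite config measure"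
  assumes m: "\<And>t. t \<ge> 0 \<Longrightarrow> m t \<in> space (prob_algebra borel)"
    and \<nu>: "\<nu> \<in> space (prob_algebra borel)"
    and lim: "\<And>f. cylinder_function f \<Longrightarrow> ((\<lambda>t. \<integral>\<eta>. f \<eta> \<partial>m t) \<longlongrightarrow> (\<integral>\<eta>. f \<eta> \<partial>\<nu>)) at_top"
  shows "converges_weakly m \<nu>"
  unfolding converges_weakly_def
proof (intro allI impI tendstoI)
  fix f :: "'d config \<Rightarrow> real" and e :: real
  assume "continuous_on UNIV f \<and> bounded (range f)" and e: "0 < e"
  then have f: "continuous_on UNIV f" and e3: "e / 3 > 0" by auto
  obtain g where g: "cylinder_function g" "\<And>\<eta>. \<bar>f \<eta> - g \<eta>\<bar> < e / 3"
    by (rule cylinder_functions_dense[OF f e3]) (rule that)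
  have cg: "continuous_on UNIV g" by (rule cylinder_continuous[OF g(1)])
  have close: "\<bar>(\<integral>\<eta>. f \<eta> \<partial>\<mu>) - (\<integral>\<eta>. g \<eta> \<partial>\<mu>)\<bar> \<le> e / 3"
    if \<mu>: "\<mu> \<in> space (prob_algebra borel)" for \<mu>
  proof -
    have eq: "(\<integral>\<eta>. f \<eta> - g \<eta> \<partial>\<mu>) = (\<integral>\<eta>. f \<eta> \<partial>\<mu>) - (\<integral>\<eta>. g \<eta> \<partial>\<mu>)"
      by (intro Bochner_Integration.integral_diff continuous_integrable \<mu> f cg)
    have c: "continuous_on UNIV (\<lambda>\<eta>. f \<eta> - g \<eta>)" by (intro continuous_intros f cg)
    have "f \<eta> - g \<eta> \<le> e / 3" "- (e / 3) \<le> f \<eta> - g \<eta>" for \<eta> using g(2)[of \<eta>] by linarith+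
    from integral_bounds(1)[OF \<mu> c this(1)] integral_bounds(2)[OF \<mu> c this(2)]
    show ?thesis unfolding eq by linarith
  qed
  have "\<forall>\<^sub>F t in at_top. dist (\<integral>\<eta>. g \<eta> \<partial>m t) (\<integral>\<eta>. g \<eta> \<partial>\<nu>) < e / 3"
    using lim[OF g(1)] e3 by (rule tendstoD)
  then show "\<forall>\<^sub>F t in at_top. dist (\<integral>\<eta>. f \<eta> \<partial>m t) (\<integral>\<eta>. f \<eta> \<partial>\<nu>) < e"
    using eventually_ge_at_top[of 0]
  proof eventually_elim
    case (elim t)
    then show ?case using close[OF m[OF elim(2)]] close[OF \<nu>] unfolding dist_real_def by linarith
  qed
qed

context noisy_exclusion
begin

lemma law_at_prob:
  assumes "\<mu> \<in> space (prob_algebra borel)" "t \<ge> 0"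
  shows "law_at P \<mu> t \<in> space (prob_algebra borel)"
  using prob_space_bind'[OF assms(1) kernel[OF assms(2)]] sets_bind'[OF assms(1) kernel[OF assms(2)]]
  by (simp add: law_at_def space_prob_algebra)

text \<open>Single sites suffice, as \<open>c\<close> times the number of particles on finitely many sites
  dominates \<open>f\<close> and \<open>- f\<close> in the sense of increments.\<close>

lemma gap_zero_everywhere:
  assumes disc: "\<And>x. disc x = 0" and f: "cylinder_function f"
  shows "gap f = 0"
proof -
  obtain A c where A: "finite A" "mono (\<lambda>\<eta>. c * (\<Sum>x\<in>A. of_bool (\<eta> x)) + f \<eta>)"
    "mono (\<lambda>\<eta>. c * (\<Sum>x\<in>A. of_bool (\<eta> x)) - f \<eta>)"
    by (rule cylinder_mono_compensation[OF f]) (rule that)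
  have cg: "cylinder_function (\<lambda>\<eta>. c * (\<Sum>x\<in>A. of_bool (\<eta> x)) :: real)"
    by (rule cylinder_weighted_sites)
  have "gap (\<lambda>\<eta>. c * (\<Sum>x\<in>A. of_bool (\<eta> x))) = c * (\<Sum>x\<in>A. disc x)"
    by (subst gap_scale) (auto simp: gap_sum disc_def intro: cylinder_sum)
  then have g0: "gap (\<lambda>\<eta>. c * (\<Sum>x\<in>A. of_bool (\<eta> x))) = 0" by (simp add: disc)
  have "0 \<le> gap (\<lambda>\<eta>. c * (\<Sum>x\<in>A. of_bool (\<eta> x)) + f \<eta>)"
    using A(2) by (rule gap_nonneg[OF cylinder_comp2[OF cg f]])
  moreover have "0 \<le> gap (\<lambda>\<eta>. c * (\<Sum>x\<in>A. of_bool (\<eta> x)) - f \<eta>)"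
    using A(3) by (rule gap_nonneg[OF cylinder_comp2[OF cg f]])
  ultimately show ?thesis by (simp add: gap_add[OF cg f] gap_diff[OF cg f] g0)
qed

text \<open>Squeezing between the two extremal initial configurations.\<close>

lemma integral_S_tendsto:
  assumes gap0: "\<And>f. cylinder_function f \<Longrightarrow> gap f = 0" and f: "cylinder_function f"
    and \<mu>: "\<mu> \<in> space (prob_algebra borel)"
  shows "((\<lambda>t. \<integral>\<eta>. S t f \<eta> \<partial>\<mu>) \<longlongrightarrow> lo f) at_top"
proof -
  have mono_case: "((\<lambda>t. \<integral>\<eta>. S t g \<eta> \<partial>\<mu>) \<longlongrightarrow> lo g) at_top" if g: "cylinder_function g" "mono g" for g
  proof (rule tendsto_sandwich)
    show "((\<lambda>t. S t g bot) \<longlongrightarrow> lo g) at_top" by (rule lo_hi_tendsto(1)[OF g(1)])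
    show "((\<lambda>t. S t g top) \<longlongrightarrow> lo g) at_top"
      using lo_hi_tendsto(2)[OF g(1)] gap0[OF g(1)] by (simp add: gap_def)
    have c: "continuous_on UNIV (S t g)" if "t \<ge> 0" for t
      using that by (intro S_continuous cylinder_continuous g(1))
    show "\<forall>\<^sub>F t in at_top. S t g bot \<le> (\<integral>\<eta>. S t g \<eta> \<partial>\<mu>)"
      using eventually_ge_at_top[of 0]
      by eventually_elim (intro integral_bounds(2)[OF \<mu> c] monoD[OF S_attractive[OF g]] bot_least)
    show "\<forall>\<^sub>F t in at_top. (\<integral>\<eta>. S t g \<eta> \<partial>\<mu>) \<le> S t g top"
      using eventually_ge_at_top[of 0]
      by eventually_elim (intro integral_bounds(1)[OF \<mu> c] monoD[OF S_attractive[OF g]] top_greatest)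
  qed
  obtain A c where A: "c \<ge> 0" "mono (\<lambda>\<eta>. c * (\<Sum>x\<in>A. of_bool (\<eta> x)) + f \<eta>)"
    by (rule cylinder_mono_compensation[OF f]) (rule that)
  define g where "g = (\<lambda>\<eta>. c * (\<Sum>x\<in>A. of_bool (\<eta> x)) :: real)"
  have g: "cylinder_function g" "mono g"
    unfolding g_def using A(1) by (intro cylinder_weighted_sites mono_weighted_sites)+
  have gf: "cylinder_function (\<lambda>\<eta>. g \<eta> + f \<eta>)" "mono (\<lambda>\<eta>. g \<eta> + f \<eta>)"
    using A(2) cylinder_comp2[OF g(1) f] by (simp_all add: g_def)
  note cont = cylinder_continuous[OF g(1)] cylinder_continuous[OF f]
  have eq: "(\<integral>\<eta>. S t (\<lambda>\<eta>. g \<eta> + f \<eta>) \<eta> \<partial>\<mu>) - (\<integral>\<eta>. S t g \<eta> \<partial>\<mu>) = (\<integral>\<eta>. S t f \<eta> \<partial>\<mu>)" if t: "t \<ge> 0" for t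
  proof -
    have "(\<integral>\<eta>. S t (\<lambda>\<eta>. g \<eta> + f \<eta>) \<eta> \<partial>\<mu>) = (\<integral>\<eta>. S t g \<eta> + S t f \<eta> \<partial>\<mu>)"
      by (simp only: S_add[OF t cont])
    also have "\<dots> = (\<integral>\<eta>. S t g \<eta> \<partial>\<mu>) + (\<integral>\<eta>. S t f \<eta> \<partial>\<mu>)"
      by (intro Bochner_Integration.integral_add continuous_integrable \<mu> S_continuous t cont)
    finally show ?thesis by simp
  qed
  have lim: "((\<lambda>t. (\<integral>\<eta>. S t (\<lambda>\<eta>. g \<eta> + f \<eta>) \<eta> \<partial>\<mu>) - (\<integral>\<eta>. S t g \<eta> \<partial>\<mu>)) \<longlongrightarrow> lo (\<lambda>\<eta>. g \<eta> + f \<eta>) - lo g) at_top"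
    by (intro tendsto_diff mono_case g gf)
  have "((\<lambda>t. S t (\<lambda>\<eta>. g \<eta> + f \<eta>) bot - S t g bot) \<longlongrightarrow> lo (\<lambda>\<eta>. g \<eta> + f \<eta>) - lo g) at_top"
    by (intro tendsto_diff lo_hi_tendsto g gf)
  then have "((\<lambda>t. S t f bot) \<longlongrightarrow> lo (\<lambda>\<eta>. g \<eta> + f \<eta>) - lo g) at_top"
    by (rule Lim_transform_eventually)
      (use eventually_ge_at_top[of 0] in eventually_elim, simp add: S_add[OF _ cont])
  then have "lo (\<lambda>\<eta>. g \<eta> + f \<eta>) - lo g = lo f"
    using lo_hi_tendsto(1)[OF f] by (rule tendsto_unique[rotated]) simp
  with lim have "((\<lambda>t. (\<integral>\<eta>. S t (\<lambda>\<eta>. g \<eta> + f \<eta>) \<eta> \<partial>\<mu>) - (\<integral>\<eta>. S t g \<eta> \<partial>\<mu>)) \<longlongrightarrow> lo f) at_top"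
    by simp
  then show ?thesis
    by (rule Lim_transform_eventually) (use eventually_ge_at_top[of 0] in eventually_elim, rule eq)
qed

lemma limit_law:
  obtains \<nu> where "\<nu> \<in> space (prob_algebra borel)"
    "\<And>f. cylinder_function f \<Longrightarrow> (\<integral>\<eta>. f \<eta> \<partial>\<nu>) = lo f"
proof (rule cylinder_functional_representation[of lo])
  fix f g :: "'d config \<Rightarrow> real" assume f: "cylinder_function f" and g: "cylinder_function g"
  show "lo (\<lambda>\<eta>. f \<eta> + g \<eta>) = lo f + lo g"
  proof (rule tendsto_unique[OF _ lo_hi_tendsto(1)])
    show "cylinder_function (\<lambda>\<eta>. f \<eta> + g \<eta>)" by (rule cylinder_comp2[OF f g])
    have "((\<lambda>t. S t f bot + S t g bot) \<longlongrightarrow> lo f + lo g) at_top"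
      by (intro tendsto_add lo_hi_tendsto f g)
    then show "((\<lambda>t. S t (\<lambda>\<eta>. f \<eta> + g \<eta>) bot) \<longlongrightarrow> lo f + lo g) at_top"
      by (rule Lim_transform_eventually)
        (use eventually_ge_at_top[of 0] in eventually_elim,
         simp add: S_add cylinder_continuous[OF f] cylinder_continuous[OF g])
  qed simp
next
  fix c and f :: "'d config \<Rightarrow> real" assume f: "cylinder_function f"
  show "lo (\<lambda>\<eta>. c * f \<eta>) = c * lo f"
  proof (rule tendsto_unique[OF _ lo_hi_tendsto(1)])
    show "cylinder_function (\<lambda>\<eta>. c * f \<eta>)" by (rule cylinder_comp[OF f])
    show "((\<lambda>t. S t (\<lambda>\<eta>. c * f \<eta>) bot) \<longlongrightarrow> c * lo f) at_top"
      unfolding S_scale by (intro tendsto_mult_left lo_hi_tendsto f)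
  qed simp
next
  fix f :: "'d config \<Rightarrow> real" assume f: "cylinder_function f" "\<And>\<eta>. 0 \<le> f \<eta>"
  show "0 \<le> lo f"
  proof (rule tendsto_lowerbound[OF lo_hi_tendsto(1)[OF f(1)]])
    show "\<forall>\<^sub>F t in at_top. 0 \<le> S t f bot"
      using eventually_ge_at_top[of 0]
      by eventually_elim (intro S_bounds(2) cylinder_continuous f)
  qed simp
next
  show "lo (\<lambda>_. 1) = 1"
  proof (rule tendsto_unique[OF _ lo_hi_tendsto(1)])
    have "S t (\<lambda>_. 1) bot = 1" if "t \<ge> 0" for t
      using that S_bounds(1)[OF that, of "\<lambda>_. 1" 1 bot] S_bounds(2)[OF that, of "\<lambda>_. 1" 1 bot] by simp
    then have "\<forall>\<^sub>F t in at_top. S t (\<lambda>_. 1) bot = 1"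
      by (rule eventually_mono[OF eventually_ge_at_top[of 0]])
    then show "((\<lambda>t. S t (\<lambda>_. 1) bot) \<longlongrightarrow> 1) at_top" by (rule tendsto_eventually)
  qed simp_all
next
  fix \<nu> assume "\<nu> \<in> space (prob_algebra borel)"
    "\<And>f. cylinder_function f \<Longrightarrow> (\<integral>\<eta>. f \<eta> \<partial>\<nu>) = lo f"
  then show thesis by (rule that)
qed

theorem ergodic_if_no_disc:
  assumes disc: "\<And>x. disc x = 0"
  shows "ergodic P"
proof -
  obtain \<nu> where \<nu>: "\<nu> \<in> space (prob_algebra borel)"
    and int: "\<And>f. cylinder_function f \<Longrightarrow> (\<integral>\<eta>. f \<eta> \<partial>\<nu>) = lo f"
    by (rule limit_law) (rule that)
  have lim: "((\<lambda>t. \<integral>\<eta>. f \<eta> \<partial>law_at P \<mu> t) \<longlongrightarrow> lo f) at_top"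
    if \<mu>: "\<mu> \<in> space (prob_algebra borel)" and f: "cylinder_function f" for \<mu> f
  proof -
    have "((\<lambda>t. \<integral>\<eta>. S t f \<eta> \<partial>\<mu>) \<longlongrightarrow> lo f) at_top"
      by (rule integral_S_tendsto[OF gap_zero_everywhere[OF disc] f \<mu>])
    then show ?thesis
      by (rule Lim_transform_eventually)
        (use eventually_ge_at_top[of 0] in eventually_elim,
         rule integral_law_at[OF \<mu> _ cylinder_continuous[OF f], symmetric])
  qed
  have conv: "converges_weakly (law_at P \<mu>) \<nu>" if \<mu>: "\<mu> \<in> space (prob_algebra borel)" for \<mu>
    by (rule weak_convergence_from_cylinders[OF law_at_prob[OF \<mu>] \<nu>]) (simp_all only: int lim[OF \<mu>])
  \<comment> \<open>\<open>S t f\<close> need not be a cylinder function, but it is continuous, so weak convergence from the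
    empty configuration gives its integral under \<open>\<nu>\<close> as the limit of \<open>S (s + t) f bot\<close>.\<close>
  have "law_at P \<nu> t = \<nu>" if t: "t \<ge> 0" for t
  proof (rule prob_eqI_cylinder[OF law_at_prob[OF \<nu> t] \<nu>])
    fix f :: "'d config \<Rightarrow> real" assume f: "cylinder_function f"
    have cf: "continuous_on UNIV f" by (rule cylinder_continuous[OF f])
    have cS: "continuous_on UNIV (S t f)" by (rule S_continuous[OF t cf])
    have \<delta>: "return borel bot \<in> space (prob_algebra borel)"
      by (simp add: space_prob_algebra prob_space_return)
    have bd: "bounded (range (S t f))"
      by (rule compact_imp_bounded[OF compact_continuous_image[OF cS compact_configs]])
    have "((\<lambda>s. \<integral>\<eta>. S t f \<eta> \<partial>law_at P (return borel bot) s) \<longlongrightarrow> (\<integral>\<eta>. S t f \<eta> \<partial>\<nu>)) at_top"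
      using conv[OF \<delta>] cS bd unfolding converges_weakly_def by simp
    moreover have "(\<integral>\<eta>. S t f \<eta> \<partial>law_at P (return borel bot) s) = S (s + t) f bot" if s: "s \<ge> 0" for s
    proof -
      have "(\<integral>\<eta>. S t f \<eta> \<partial>law_at P (return borel bot) s) = (\<integral>\<eta>. S s (S t f) \<eta> \<partial>return borel bot)"
        by (rule integral_law_at[OF \<delta> s cS])
      also have "\<dots> = S s (S t f) bot"
        by (rule integral_return) (auto intro: borel_measurable_config S_continuous s cS)
      also have "\<dots> = S (s + t) f bot" by (rule S_add_time[OF s t cf, symmetric])
      finally show ?thesis .
    qed
    then have "\<forall>\<^sub>F s in at_top. (\<integral>\<eta>. S t f \<eta> \<partial>law_at P (return borel bot) s) = S (s + t) f bot"
      by (rule eventually_mono[OF eventually_ge_at_top[of 0]])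
    ultimately have "((\<lambda>s. S (s + t) f bot) \<longlongrightarrow> (\<integral>\<eta>. S t f \<eta> \<partial>\<nu>)) at_top"
      by (rule Lim_transform_eventually)
    moreover have "((\<lambda>s. S (s + t) f bot) \<longlongrightarrow> lo f) at_top"
      using filterlim_tendsto_add_at_top[OF tendsto_const filterlim_ident, of t]
      by (intro filterlim_compose[OF lo_hi_tendsto(1)[OF f]]) (simp add: add.commute)
    ultimately have "(\<integral>\<eta>. S t f \<eta> \<partial>\<nu>) = lo f" by (rule tendsto_unique[rotated]) simp
    then show "(\<integral>\<eta>. f \<eta> \<partial>law_at P \<nu> t) = (\<integral>\<eta>. f \<eta> \<partial>\<nu>)"
      by (simp only: integral_law_at[OF \<nu> t cf] int[OF f])
  qed
  then have inv: "invariant_law P \<nu>" using \<nu> by (simp add: invariant_law_def)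
  have "\<nu>' = \<nu>" if "invariant_law P \<nu>'" for \<nu>'
  proof -
    have \<nu>': "\<nu>' \<in> space (prob_algebra borel)" "\<And>t. t \<ge> 0 \<Longrightarrow> law_at P \<nu>' t = \<nu>'"
      using that by (auto simp: invariant_law_def)
    show ?thesis
    proof (rule prob_eqI_cylinder[OF \<nu>'(1) \<nu>])
      fix f :: "'d config \<Rightarrow> real" assume f: "cylinder_function f"
      have "\<forall>\<^sub>F t in at_top. (\<integral>\<eta>. f \<eta> \<partial>law_at P \<nu>' t) = (\<integral>\<eta>. f \<eta> \<partial>\<nu>')"
        using eventually_ge_at_top[of 0] by eventually_elim (simp only: \<nu>'(2))
      with lim[OF \<nu>'(1) f] have "((\<lambda>t :: real. \<integral>\<eta>. f \<eta> \<partial>\<nu>') \<longlongrightarrow> lo f) at_top"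
        by (rule Lim_transform_eventually)
      then have "(\<integral>\<eta>. f \<eta> \<partial>\<nu>') = lo f" by (simp add: tendsto_const_iff)
      then show "(\<integral>\<eta>. f \<eta> \<partial>\<nu>') = (\<integral>\<eta>. f \<eta> \<partial>\<nu>)" by (simp only: int[OF f])
    qed
  qed
  with inv conv show ?thesis unfolding ergodic_def by (intro exI[of _ \<nu>] conjI allI impI ballI)
qed

end

lemma shells_separated:
  fixes p :: "nat \<Rightarrow> real"
  assumes step: "\<And>l. l \<ge> 1 \<Longrightarrow> p (l + 1) \<ge> p l + real N" and ij: "1 \<le> i" "i < j"
  shows "p i + real N \<le> p j"
  using ij(2)
proof (induction j)
  case (Suc j)
  have s: "p (Suc j) \<ge> p j + real N" if "j \<ge> 1" using step[OF that] by simp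
  show ?case
  proof (cases "i = j")
    case True
    then show ?thesis using s ij(1) by simp
  next
    case False
    then have "i < j" using Suc.prems by simp
    then show ?thesis using s Suc.IH ij(1) by simp
  qed
qed simp

theorem theorem1p7:
  fixes q :: "int ^ 'd \<Rightarrow> int ^ 'd \<Rightarrow> real"
    and \<beta> \<delta> :: "int ^ 'd \<Rightarrow> real"
    and P :: "real \<Rightarrow> 'd config \<Rightarrow> 'd config measure"
    and N :: nat
    and b p :: "nat \<Rightarrow> real"
  assumes process: "noisy_exclusion_process q \<beta> \<delta> P"
    and irreducible: "irreducible_rates q"
    and range: "finite_range N q"
    and b_nonneg: "\<And>l. l \<ge> 1 \<Longrightarrow> b l \<ge> 0"
    and b_dim1: "CARD('d) = 1 \<Longrightarrow> filterlim (\<lambda>n. \<Sum>l=1..n. b l) at_top sequentially"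
    and b_dim2: "CARD('d) \<ge> 2 \<Longrightarrow> filterlim (\<lambda>l. real l * b l) at_top sequentially"
    and p_nonneg: "\<And>l. l \<ge> 1 \<Longrightarrow> p l \<ge> 0"
    and p_step: "\<And>l. l \<ge> 1 \<Longrightarrow> p (l + 1) \<ge> p l + real N"
    and p_bound: "\<exists>k>0. \<forall>l\<ge>1. p l \<le> k * real l powr k"
    and noise_on: "\<And>l x. l \<ge> 1 \<Longrightarrow> x \<in> T_shell N (p l) \<Longrightarrow> \<beta> x + \<delta> x \<ge> b l"
    and noise_off: "\<And>x. (\<forall>l\<ge>1. x \<notin> T_shell N (p l)) \<Longrightarrow> \<beta> x = 0 \<and> \<delta> x = 0"
  shows "ergodic P"
proof -
  interpret noisy_exclusion q \<beta> \<delta> P N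
    using process range by unfold_locales
  define A where "A = (\<lambda>l. \<Sum>x\<in>T_shell N (p l). disc x)"
  obtain K where K: "K > 0"
    and flux: "\<And>r. (\<Sum>x\<in>T_box r. (\<beta> x + \<delta> x) * disc x) \<le> K * (\<Sum>x\<in>T_shell N r. disc x)"
    by (rule flux_inequality) (rule that)
  have apart: "p i + real N \<le> p j" if "1 \<le> i" "i < j" for i j
    using shells_separated[of p N i j] p_step that by blast
  have sums: "(\<Sum>j=1..<l. b j * A j) \<le> K * A l" if "l \<ge> 1" for l
  proof -
    have sub: "T_shell N (p j) \<subseteq> T_box (p l)" if "j \<in> {1..<l}" for j
      using T_box_mono[OF apart[of j l]] that by (auto simp: T_shell_def)
    have disj: "T_shell N (p i) \<inter> T_shell N (p j) = {}" if "1 \<le> i" "i < j" for i j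
      using T_box_mono[OF apart[OF that]] by (auto simp: T_shell_def)
    have "(\<Sum>j=1..<l. b j * A j) = (\<Sum>j=1..<l. \<Sum>x\<in>T_shell N (p j). b j * disc x)"
      by (simp add: A_def sum_distrib_left)
    also have "\<dots> \<le> (\<Sum>j=1..<l. \<Sum>x\<in>T_shell N (p j). (\<beta> x + \<delta> x) * disc x)"
      by (intro sum_mono mult_right_mono noise_on) auto
    also have "\<dots> = (\<Sum>x\<in>(\<Union>j\<in>{1..<l}. T_shell N (p j)). (\<beta> x + \<delta> x) * disc x)"
    proof (rule sum.UNION_disjoint[symmetric])
      show "\<forall>i\<in>{1..<l}. \<forall>j\<in>{1..<l}. i \<noteq> j \<longrightarrow> T_shell N (p i) \<inter> T_shell N (p j) = {}"
        using disj by (metis Int_commute atLeastLessThan_iff nat_neq_iff)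
    qed auto
    also have "\<dots> \<le> (\<Sum>x\<in>T_box (p l). (\<beta> x + \<delta> x) * disc x)"
      by (intro sum_mono2 UN_least sub) auto
    also have "\<dots> \<le> K * A l" unfolding A_def by (rule flux)
    finally show ?thesis .
  qed
  have card_bound: "A l \<le> real (card (T_shell N (p l) :: (int ^ 'd) set))" for l
    unfolding A_def using sum_bounded_above[of "T_shell N (p l)" disc 1] disc_le_1 by simp
  have "\<exists>l\<ge>1. A l = 0"
  proof (rule ccontr)
    assume "\<not> ?thesis"
    moreover have "A l \<ge> 0" for l unfolding A_def by (intro sum_nonneg) simp
    ultimately have pos: "A l > 0" if "l \<ge> 1" for l using that by (metis less_le)
    consider "CARD('d) = 1" | "CARD('d) \<ge> 2"
      using zero_less_card_finite[where 'a = 'd] by linarith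
    then show False
    proof cases
      case 1
      have "A l \<le> 2 * real N" for l
      proof -
        have "real (card (T_shell N (p l) :: (int ^ 'd) set)) \<le> real (2 * N)"
          by (intro of_nat_mono card_T_shell_line 1)
        then show ?thesis using card_bound[of l] by simp
      qed
      then show False
        using divergent_weights_exclude_bounded[OF b_nonneg pos K sums _ b_dim1[OF 1]] by blast
    next
      case 2
      obtain k where k: "k > 0" "\<And>l. l \<ge> 1 \<Longrightarrow> p l \<le> k * real l powr k" using p_bound by blast
      \<comment> \<open>An integer exponent, as the growth lemma needs it.\<close>
      define m where "m = nat \<lceil>k\<rceil>"
      define c where "c = 2 * k + 2 * real N + 1"
      have "A l \<le> c ^ CARD('d) * real l ^ (m * CARD('d))" if l: "l \<ge> 1" for l
      proof -
        have "real l powr k \<le> real l powr real m"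
          using l by (intro powr_mono) (auto simp: m_def real_nat_ceiling_ge)
        also have "\<dots> = real l ^ m" using l by (simp add: powr_realpow)
        finally have pl: "p l \<le> k * real l ^ m"
          using k(2)[OF l] k(1) by (meson less_imp_le mult_left_mono order_trans)
        have "1 \<le> real l ^ m" using l by simp
        then have "2 * real N + 1 \<le> (2 * real N + 1) * real l ^ m" by simp
        then have "2 * (p l + real N) + 1 \<le> c * real l ^ m"
          using pl unfolding c_def by (simp add: algebra_simps)
        then have "(2 * (p l + real N) + 1) ^ CARD('d) \<le> (c * real l ^ m) ^ CARD('d)"
          using p_nonneg[OF l] by (intro power_mono) auto
        moreover have "real (card (T_shell N (p l) :: (int ^ 'd) set)) \<le> real (card (T_box (p l + real N) :: (int ^ 'd) set))"
          by (intro of_nat_mono card_mono) (auto simp: T_shell_def)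
        moreover have "real (card (T_box (p l + real N) :: (int ^ 'd) set)) \<le> (2 * (p l + real N) + 1) ^ CARD('d)"
          using p_nonneg[OF l] by (intro card_T_box) simp
        ultimately show ?thesis
          using card_bound[of l] by (simp add: power_mult_distrib power_mult)
      qed
      then show False
        using slow_weights_exclude_polynomial[OF b_nonneg pos K sums _ b_dim2[OF 2]] by blast
    qed
  qed
  then obtain l where l: "l \<ge> 1" "A l = 0" by blast
  \<comment> \<open>A shell of width 0 is empty and would say nothing about any site.\<close>
  have "N \<noteq> 0"
  proof
    assume N: "N = 0"
    have stay: "u = v" if "q u v > 0" for u v
    proof -
      have "lattice_norm (u - v) \<le> 0" using range_zero[of u v] that N by force
      then show ?thesis by (simp add: lattice_norm_le_iff vec_eq_iff)
    qed
    have "(\<lambda>u v. q u v > 0)\<^sup>*\<^sup>* 0 1" using irreducible by (simp add: irreducible_rates_def)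
    then have "(1 :: int ^ 'd) = 0"
      by (induction rule: rtranclp_induct) (auto dest: stay)
    then show False by (simp add: vec_eq_iff)
  qed
  then have N: "real N \<ge> 1" by simp
  define x :: "int ^ 'd" where "x = (\<chi> i. \<lfloor>p l\<rfloor> + 1)"
  have "\<bar>x $ i\<bar> = \<lfloor>p l\<rfloor> + 1" for i using p_nonneg[OF l(1)] by (simp add: x_def)
  moreover have "real_of_int (\<lfloor>p l\<rfloor> + 1) \<le> p l + real N" "\<not> real_of_int (\<lfloor>p l\<rfloor> + 1) \<le> p l"
    using N by linarith+
  ultimately have "x \<in> T_shell N (p l)"
    unfolding T_shell_def T_box_def by (simp only: Diff_iff mem_Collect_eq simp_thms)
  then have "disc x = 0"
    using l(2) unfolding A_def by (subst (asm) sum_nonneg_eq_0_iff) auto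
  then show ?thesis
    by (rule ergodic_if_no_disc[OF disc_zero_everywhere[OF irreducible]])
qed

end
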